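(* Let $G$ be a finite connected regular simple graph with edge set $E$ and constant edge degree $d'(e)=2q\ge 4$ for all $e\in E$ (so every vertex has degree $q+1$). There is a constant $C_G>0$ depending only on $G$ such that for every function $f:E\to\mathbb{R}$ there is a number $\beta_{\max}\in\{\tfrac1q\}\cup[q^{-1/2},1)$ such that both of the following hold with these same constants: (i) for every directed edge $a$ in $G$ and every integer $r\ge 0$, $\big|M_{r,a}(f)-\frac{1}{|E|}\sum_{e\in E}f(e)\big|\le C_G\|f\|_2\beta_{\max}^{\,r}$; (ii) for every vertex $v_0$ of the universal covering tree $\widetilde G$ and every integer $r\ge 0$, $$\Big|\frac{1}{|S'_r(v_0)|}\sum_{e\in S'_r(v_0)}\tilde f(e)-\frac{1}{|E|}\sum_{e\in E}f(e)\Big|\le C_G\,\|f\|_2\,\beta_{\max}^{\,r}.$$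
   Context: Simple means no loops and no multiple edges. The edge degree $d'(e)$ is the number of edges meeting $e$ in either of its endpoints. The norm is $\|f\|_2=\langle f,f\rangle^{1/2}$ with $\langle f,g\rangle=\sum_{e\in E}f(e)g(e)$. Universal cover: $\widetilde G$ is the universal covering tree of $G$, with vertex set $\widetilde V$ and edge set $\widetilde E$: fix a root vertex of $G$; the vertices of $\widetilde G$ are the non-backtracking paths in $G$ starting at the root, two being adjacent if they differ by exactly one edge at the end. The projection $\pi:\widetilde G\to G$ sends a path to its end vertex, and $\pi(\{\tilde v,\tilde w\})=\{\pi(\tilde v),\pi(\tilde w)\}$ on edges. The lift of $f$ is $\tilde f=f\circ\pi$. $\delta$ is the combinatorial distance between vertices. Edge spheres and arcs: for $v_0\in\widetilde V$, $S'_r(v_0)=\{e=\{x,y\}\in\widetilde E:\min\{\delta(x,v_0),\delta(y,v_0)\}=r\}$. For a directed edge $a$ of $\widetilde G$ from $w'$ to $w$, $A'_0(a)=\{a\}$ and $A'_{r+1}(a)=S'_{r+1}(w')\cap S'_r(w)$ for $r\ge0$, and $M_{r,a}(f)=\frac{1}{|A'_r(a)|}\sum_{x\in A'_r(a)}\tilde f(x)$. For a directed edge $a$ of $G$, $M_{r,a}(f)$ is computed using any lift of $a$ to $\widetilde G$ (the value does not depend on the lift). The constant $C_G$ does not depend on $a$, $v_0$, $f$, $r$; the rate $\beta_{\max}$ may depend on $G$ and $f$ but not on $a$, $v_0$ or $r$. *)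

theory Defs
  imports Complex_Main
begin

(* A graph is given by a vertex set V and a set E of two-element subsets of V. *)

definition simple_graph :: "'a set \<Rightarrow> 'a set set \<Rightarrow> bool" where
  "simple_graph V E \<longleftrightarrow> (\<forall>e\<in>E. e \<subseteq> V \<and> card e = 2)"

definition walk :: "'a set \<Rightarrow> 'a set set \<Rightarrow> 'a list \<Rightarrow> bool" where
  "walk V E p \<longleftrightarrow> p \<noteq> [] \<and> set p \<subseteq> V \<and> (\<forall>i. Suc i < length p \<longrightarrow> {p ! i, p ! Suc i} \<in> E)"

definition connected_graph :: "'a set \<Rightarrow> 'a set set \<Rightarrow> bool" where
  "connected_graph V E \<longleftrightarrow>
     V \<noteq> {} \<and> (\<forall>u\<in>V. \<forall>v\<in>V. \<exists>p. walk V E p \<and> hd p = u \<and> last p = v)"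

definition graph_dist :: "'a set \<Rightarrow> 'a set set \<Rightarrow> 'a \<Rightarrow> 'a \<Rightarrow> nat" where
  "graph_dist V E u v = (LEAST n. \<exists>p. walk V E p \<and> hd p = u \<and> last p = v \<and> length p = Suc n)"

definition degree :: "'a set set \<Rightarrow> 'a \<Rightarrow> nat" where
  "degree E v = card {e \<in> E. v \<in> e}"

definition regular_graph :: "'a set \<Rightarrow> 'a set set \<Rightarrow> bool" where
  "regular_graph V E \<longleftrightarrow> (\<exists>k. \<forall>v\<in>V. degree E v = k)"

(* The edge itself is not counted: d'({x,y}) = (deg x - 1) + (deg y - 1). *)
definition edge_degree :: "'a set set \<Rightarrow> 'a set \<Rightarrow> nat" where
  "edge_degree E e = card {e' \<in> E. e' \<noteq> e \<and> e' \<inter> e \<noteq> {}}"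

definition edge_inner :: "'a set set \<Rightarrow> ('a set \<Rightarrow> real) \<Rightarrow> ('a set \<Rightarrow> real) \<Rightarrow> real" where
  "edge_inner E f g = (\<Sum>e\<in>E. f e * g e)"

definition edge_norm :: "'a set set \<Rightarrow> ('a set \<Rightarrow> real) \<Rightarrow> real" where
  "edge_norm E f = sqrt (edge_inner E f f)"

definition mean :: "'b set \<Rightarrow> ('b \<Rightarrow> real) \<Rightarrow> real" where
  "mean A g = (1 / real (card A)) * (\<Sum>x\<in>A. g x)"


(* Paths are lists of vertices; the trivial path at the root rt is [rt]. *)

definition cover_verts :: "'a set \<Rightarrow> 'a set set \<Rightarrow> 'a \<Rightarrow> 'a list set" where
  "cover_verts V E rt =
     {p. walk V E p \<and> hd p = rt \<and> (\<forall>i. i + 2 < length p \<longrightarrow> p ! i \<noteq> p ! (i + 2))}"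

definition cover_edges :: "'a set \<Rightarrow> 'a set set \<Rightarrow> 'a \<Rightarrow> 'a list set set" where
  "cover_edges V E rt =
     {{p, p @ [x]} | p x. p \<in> cover_verts V E rt \<and> p @ [x] \<in> cover_verts V E rt}"

definition proj_vert :: "'a list \<Rightarrow> 'a" where
  "proj_vert p = last p"

definition proj_edge :: "'a list set \<Rightarrow> 'a set" where
  "proj_edge e = proj_vert ` e"

definition lift_fun :: "('a set \<Rightarrow> real) \<Rightarrow> 'a list set \<Rightarrow> real" where
  "lift_fun f = f \<circ> proj_edge"


definition edge_sphere :: "'a set \<Rightarrow> 'a set set \<Rightarrow> nat \<Rightarrow> 'a \<Rightarrow> 'a set set" where
  "edge_sphere V E r v =
     {e \<in> E. \<exists>x y. e = {x, y} \<and> min (graph_dist V E x v) (graph_dist V E y v) = r}"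

(* The pair (u, v) is the edge {u, v} directed from u to v. *)

definition directed_edges :: "'a set set \<Rightarrow> ('a \<times> 'a) set" where
  "directed_edges E = {(u, v). {u, v} \<in> E}"

fun edge_arc :: "'a set \<Rightarrow> 'a set set \<Rightarrow> nat \<Rightarrow> 'a \<times> 'a \<Rightarrow> 'a set set" where
  "edge_arc V E 0 (w', w) = {{w', w}}"
| "edge_arc V E (Suc r) (w', w) = edge_sphere V E (Suc r) w' \<inter> edge_sphere V E r w"

definition cover_sphere :: "'a set \<Rightarrow> 'a set set \<Rightarrow> 'a \<Rightarrow> nat \<Rightarrow> 'a list \<Rightarrow> 'a list set set" where
  "cover_sphere V E rt r v =
     edge_sphere (cover_verts V E rt) (cover_edges V E rt) r v"

definition arc_mean ::
    "'a set \<Rightarrow> 'a set set \<Rightarrow> 'a \<Rightarrow> nat \<Rightarrow> 'a list \<times> 'a list \<Rightarrow> ('a set \<Rightarrow> real) \<Rightarrow> real" where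
  "arc_mean V E rt r b f =
     mean (edge_arc (cover_verts V E rt) (cover_edges V E rt) r b) (lift_fun f)"

definition arc_lifts ::
    "'a set \<Rightarrow> 'a set set \<Rightarrow> 'a \<Rightarrow> 'a \<times> 'a \<Rightarrow> ('a list \<times> 'a list) set" where
  "arc_lifts V E rt a =
     {b \<in> directed_edges (cover_edges V E rt). map_prod proj_vert proj_vert b = a}"


(* Directed edges of a connected graph do have lifts, so quantifying over all lifts
   is never vacuous. *)

lemma walk_snoc:
  assumes "walk V E p" "x \<in> V" "{last p, x} \<in> E"
  shows "walk V E (p @ [x])"
  using assms unfolding walk_def
  by (auto simp: nth_append last_conv_nth less_Suc_eq)
     (metis One_nat_def diff_Suc_1 less_antisym)

lemma cover_snoc:
  assumes p: "p \<in> cover_verts V E rt" and x: "x \<in> V" "{last p, x} \<in> E"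
    and nb: "length p \<ge> 2 \<Longrightarrow> p ! (length p - 2) \<noteq> x"
  shows "p @ [x] \<in> cover_verts V E rt"
proof -
  have w: "walk V E p" and h: "hd p = rt"
    and n: "\<And>i. i + 2 < length p \<Longrightarrow> p ! i \<noteq> p ! (i + 2)"
    using p by (auto simp: cover_verts_def)
  have "(p @ [x]) ! i \<noteq> (p @ [x]) ! (i + 2)" if "i + 2 < length (p @ [x])" for i
  proof (cases "i + 2 < length p")
    case True
    then show ?thesis using n[of i] by (simp add: nth_append)
  next
    case False
    then have "i + 2 = length p" using that by simp
    then have "i = length p - 2" "length p \<ge> 2" "i < length p" "(p @ [x]) ! (i + 2) = x"
      by (auto simp: nth_append)
    then show ?thesis using nb by (metis nth_append)
  qed
  moreover have "hd (p @ [x]) = rt" using w h by (simp add: walk_def)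
  ultimately show ?thesis using walk_snoc[OF w x] by (simp add: cover_verts_def)
qed

lemma cover_step:
  assumes p: "p \<in> cover_verts V E rt" and x: "x \<in> V" "{last p, x} \<in> E"
  shows "\<exists>p'\<in>cover_verts V E rt. last p' = x \<and> {p, p'} \<in> cover_edges V E rt"
proof (cases "length p \<ge> 2 \<and> p ! (length p - 2) = x")
  case False
  then have "p @ [x] \<in> cover_verts V E rt" using cover_snoc[OF p x] by blast
  then show ?thesis using p by (intro bexI[of _ "p @ [x]"]) (auto simp: cover_edges_def)
next
  case True
  then have ne: "p \<noteq> []" "butlast p \<noteq> []" by (auto simp: butlast_conv_take)
  have w: "walk V E p" and h: "hd p = rt"
    and n: "\<And>i. i + 2 < length p \<Longrightarrow> p ! i \<noteq> p ! (i + 2)"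
    using p by (auto simp: cover_verts_def)
  have bl: "butlast p ! i = p ! i" if "i < length p - 1" for i
    using that by (simp add: nth_butlast)
  have st: "{p ! i, p ! Suc i} \<in> E" if "Suc i < length p" for i
    using w that by (simp add: walk_def)
  have "walk V E (butlast p)"
    unfolding walk_def
  proof (intro conjI allI impI)
    fix i assume "Suc i < length (butlast p)"
    then show "{butlast p ! i, butlast p ! Suc i} \<in> E" using st[of i] by (simp add: bl)
  qed (use w ne in \<open>auto simp: walk_def dest: in_set_butlastD\<close>)
  moreover have "hd (butlast p) = rt" using h ne by (cases p) auto
  moreover have "butlast p ! i \<noteq> butlast p ! (i + 2)" if "i + 2 < length (butlast p)" for i
  proof -
    have "butlast p ! i = p ! i" "butlast p ! (i + 2) = p ! (i + 2)" using that by (auto intro!: bl)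
    then show ?thesis using n[of i] that by simp
  qed
  ultimately have bp: "butlast p \<in> cover_verts V E rt" by (simp add: cover_verts_def)
  have "last (butlast p) = x"
  proof -
    have "length p - 2 < length p - 1" using True by linarith
    then show ?thesis using True ne bl[of "length p - 2"]
      by (simp add: last_conv_nth numeral_2_eq_2)
  qed
  moreover have "{p, butlast p} \<in> cover_edges V E rt"
  proof -
    have "p = butlast p @ [last p]" using ne by simp
    then show ?thesis using p bp unfolding cover_edges_def
      by (intro CollectI exI[of _ "butlast p"] exI[of _ "last p"]) auto
  qed
  ultimately show ?thesis using bp by blast
qed

lemma cover_reaches:
  assumes "walk V E p" "hd p = rt"
  shows "\<exists>p'\<in>cover_verts V E rt. last p' = last p"
  using assms
proof (induction p rule: rev_induct)
  case Nil
  then show ?case by (simp add: walk_def)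
next
  case (snoc x p)
  show ?case
  proof (cases "p = []")
    case True
    then show ?thesis using snoc.prems
      by (intro bexI[of _ "[x]"]) (auto simp: cover_verts_def)
  next
    case False
    have st: "{(p @ [x]) ! i, (p @ [x]) ! Suc i} \<in> E" if "Suc i < length (p @ [x])" for i
      using snoc.prems(1) that unfolding walk_def by blast
    have w: "walk V E p" unfolding walk_def
    proof (intro conjI allI impI)
      fix i assume "Suc i < length p"
      then show "{p ! i, p ! Suc i} \<in> E" using st[of i] by (simp add: nth_append)
    qed (use False snoc.prems in \<open>auto simp: walk_def\<close>)
    have "{last p, x} \<in> E"
      using st[of "length p - 1"] False by (simp add: nth_append last_conv_nth)
    moreover have "x \<in> V" using snoc.prems by (simp add: walk_def)
    moreover obtain p' where "p' \<in> cover_verts V E rt" "last p' = last p"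
      using snoc.IH[OF w] snoc.prems False by auto
    ultimately show ?thesis using cover_step[of p' V E rt x] by auto
  qed
qed

lemma arc_lifts_nonempty:
  assumes "simple_graph V E" "connected_graph V E" "rt \<in> V" "a \<in> directed_edges E"
  shows "arc_lifts V E rt a \<noteq> {}"
proof -
  obtain u v where a: "a = (u, v)" "{u, v} \<in> E"
    using assms(4) by (auto simp: directed_edges_def)
  then have uv: "u \<in> V" "v \<in> V" using assms(1) by (auto simp: simple_graph_def)
  then obtain p where "walk V E p" "hd p = rt" "last p = u"
    using assms(2,3) unfolding connected_graph_def by blast
  then obtain p' where p': "p' \<in> cover_verts V E rt" "last p' = u"
    using cover_reaches by metis
  then obtain p'' where "last p'' = v" "{p', p''} \<in> cover_edges V E rt"
    using cover_step[OF p'(1) uv(2)] a by auto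
  then have "(p', p'') \<in> arc_lifts V E rt a"
    using p' a by (simp add: arc_lifts_def directed_edges_def proj_vert_def)
  then show ?thesis by blast
qed

end

theory Submission
  imports Defs "HOL-Library.Sublist"
begin

text \<open>
The arc of radius r over a directed edge (u, v) consists of the last edges of the non-backtracking
paths that continue (u, v) by r further edges, each edge reached exactly once. Hence the arc
average of f is the value at (u, v) of the r-th power of the operator
P (nb_average below), which replaces a function H on directed edges by its average
over the q forward continuations of an edge, applied to the function that f induces on directed
edges. A sphere is the disjoint union of the q + 1 arcs over the edges that leave its centre, so
sphere means are averages of arc means. All that remains is a geometric bound on P^r.

That bound comes from an exact energy identity (sq_norm_loss). At each vertex v the operator P
acts as a matrix with eigenvalue 1 on constants and -1/q on vectors of sum zero, so the loss of
squared norm under P measures how far H(v, .) is from being constant, summed over v. If P \<circ>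
P loses almost nothing, then H(v, x) hardly depends on x, and, by the same remark applied to P H,
hardly changes when v is replaced by a vertex at distance two. Chaining such moves shows that H is
almost constant on the edges leaving any class of vertices joined by walks of even length. If H
has mean zero on each of these classes (it is then called balanced), H itself must be small. So P
\<circ> P contracts balanced functions by a fixed factor below 1 (two_step_contraction), and P
preserves balance (balanced_average).

A graph has one such class, or two if it is bipartite. In the bipartite case a function of total
mean zero need not be balanced, and P^r H need not tend to zero. However, a function on directed
edges that comes from undirected edges takes the same values in both directions, so its sums over
the two classes agree, and mean zero makes it balanced (symmetric_balanced). The rate found in
this way depends on the graph only, not on f.
\<close>

section \<open>Arcs and spheres in a tree\<close>

text \<open>
Functions on directed edges are curried functions of tail and head. The value at (u, v) is the
average over the q edges (v, x) that continue (u, v) without backtracking when v has degree q + 1.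
\<close>

definition nb_average ::
    "('a \<Rightarrow> 'a set) \<Rightarrow> nat \<Rightarrow> ('a \<Rightarrow> 'a \<Rightarrow> real) \<Rightarrow> 'a \<Rightarrow> 'a \<Rightarrow> real" where
  "nb_average N q H u v = (\<Sum>x\<in>N v - {u}. H v x) / real q"

text \<open>
These axioms are the properties of a tree that make arcs and spheres computable: the distance
changes by exactly one along an edge, and from every vertex exactly one edge leads towards any
given other vertex.
\<close>

locale tree_metric =
  fixes W :: "'v set" and F :: "'v set set"
  assumes edge_in: "{x, y} \<in> F \<Longrightarrow> x \<in> W \<and> y \<in> W"
    and dist_self: "x \<in> W \<Longrightarrow> graph_dist W F x x = 0"
    and dist_zero: "x \<in> W \<Longrightarrow> y \<in> W \<Longrightarrow> graph_dist W F x y = 0 \<Longrightarrow> x = y"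
    and dist_sym: "x \<in> W \<Longrightarrow> y \<in> W \<Longrightarrow> graph_dist W F x y = graph_dist W F y x"
    and dist_step: "{x, y} \<in> F \<Longrightarrow> v \<in> W \<Longrightarrow>
          graph_dist W F x v = Suc (graph_dist W F y v) \<or>
          graph_dist W F y v = Suc (graph_dist W F x v)"
    and closer_neighbour: "v \<in> W \<Longrightarrow> y \<in> W \<Longrightarrow> v \<noteq> y \<Longrightarrow>
          \<exists>!w. {v, w} \<in> F \<and> graph_dist W F y v = Suc (graph_dist W F y w)"
begin

abbreviation d :: "'v \<Rightarrow> 'v \<Rightarrow> nat" where "d \<equiv> graph_dist W F"

text \<open>
The edges whose nearer endpoint is at distance r from v and which are reached from v through its
neighbour w. The condition is put on the farther endpoint y because y is never v itself, not even
for r = 0; the direction from v towards y is therefore always defined.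
\<close>

definition branch :: "nat \<Rightarrow> 'v \<Rightarrow> 'v \<Rightarrow> 'v set set" where
  "branch r v w =
     {e. \<exists>x y. e = {x, y} \<and> {x, y} \<in> F \<and> d x v = r \<and> d y v = Suc r \<and> d y w = r}"

lemma dist_step': "{v, w} \<in> F \<Longrightarrow> y \<in> W \<Longrightarrow> d y v = Suc (d y w) \<or> d y w = Suc (d y v)"
  using dist_step[of v w y] dist_sym[of y v] dist_sym[of y w] edge_in[of v w] by auto

lemma closer_unique:
  assumes "{v, w} \<in> F" "{v, w'} \<in> F" "y \<in> W" "d y v = Suc (d y w)" "d y v = Suc (d y w')"
  shows "w = w'"
proof -
  have "v \<in> W" using edge_in assms(1) by blast
  moreover have "v \<noteq> y" using dist_self[OF assms(3)] assms(4) by auto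
  ultimately show ?thesis using closer_neighbour[of v y] assms by blast
qed

lemma edge_sphere_iff:
  assumes "v \<in> W"
  shows "e \<in> edge_sphere W F r v \<longleftrightarrow>
    (\<exists>x y. e = {x, y} \<and> {x, y} \<in> F \<and> d x v = r \<and> d y v = Suc r)"
proof
  assume "e \<in> edge_sphere W F r v"
  then obtain x y where *: "e = {x, y}" "{x, y} \<in> F" "min (d x v) (d y v) = r"
    unfolding edge_sphere_def by blast
  have "{y, x} = {x, y}" by auto
  then show "\<exists>x y. e = {x, y} \<and> {x, y} \<in> F \<and> d x v = r \<and> d y v = Suc r"
    using dist_step[OF *(2) assms] *
    by (metis lessI less_imp_le_nat min.absorb1 min.absorb2)
next
  assume "\<exists>x y. e = {x, y} \<and> {x, y} \<in> F \<and> d x v = r \<and> d y v = Suc r"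
  then show "e \<in> edge_sphere W F r v" unfolding edge_sphere_def by fastforce
qed

text \<open>
Both endpoints of an edge not incident to v lie in the same direction from v: the neighbour of v
towards the nearer endpoint x also decreases the distance to y, hence equals w.
\<close>

lemma near_endpoint_follows:
  assumes vw: "{v, w} \<in> F" and xy: "{x, y} \<in> F"
    and dx: "d x v = Suc r" and dy: "d y v = Suc (Suc r)" and dw: "d y w = Suc r"
  shows "d x w = r"
proof -
  have W: "v \<in> W" "w \<in> W" "x \<in> W" "y \<in> W" using edge_in vw xy by blast+
  have "v \<noteq> x" using dist_self[OF W(3)] dx by auto
  then obtain w' where w': "{v, w'} \<in> F" "d x v = Suc (d x w')"
    using closer_neighbour[OF W(1,3)] by blast
  have "w' \<in> W" using edge_in w'(1) by blast
  then have "d y w' = Suc r"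
    using dist_step'[OF w'(1) W(4)] dist_step[OF xy, of w'] w'(2) dx dy by linarith
  then have "w' = w" using closer_unique[OF w'(1) vw W(4)] dy dw by simp
  then show ?thesis using w' dx by simp
qed

lemma arc_eq_branch:
  assumes vw: "{v, w} \<in> F"
  shows "edge_arc W F r (v, w) = branch r v w"
proof (cases r)
  case 0
  have W: "v \<in> W" "w \<in> W" using edge_in vw by blast+
  have "{v, w} \<in> branch 0 v w"
    unfolding branch_def using vw W dist_self dist_step'[OF vw W(2)] by force
  moreover have "e = {v, w}" if "e \<in> branch 0 v w" for e
    using that dist_zero W edge_in unfolding branch_def by blast
  ultimately have "branch 0 v w = {{v, w}}" by blast
  then show ?thesis using 0 by simp
next
  case (Suc s)
  have W: "v \<in> W" "w \<in> W" using edge_in vw by blast+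
  have "e \<in> edge_sphere W F (Suc s) v \<inter> edge_sphere W F s w \<longleftrightarrow> e \<in> branch (Suc s) v w" for e
  proof
    assume "e \<in> branch (Suc s) v w"
    then obtain x y where *: "e = {x, y}" "{x, y} \<in> F" "d x v = Suc s" "d y v = Suc (Suc s)"
      "d y w = Suc s" unfolding branch_def by blast
    then have "d x w = s" using near_endpoint_follows[OF vw] by blast
    then show "e \<in> edge_sphere W F (Suc s) v \<inter> edge_sphere W F s w"
      using * W by (auto simp: edge_sphere_iff)
  next
    assume *: "e \<in> edge_sphere W F (Suc s) v \<inter> edge_sphere W F s w"
    then obtain x y where xy: "e = {x, y}" "{x, y} \<in> F" "d x v = Suc s" "d y v = Suc (Suc s)"
      using W by (auto simp: edge_sphere_iff)
    obtain x' y' where xy': "e = {x', y'}" "d x' w = s" "d y' w = Suc s"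
      using * W by (auto simp: edge_sphere_iff)
    have "x \<in> W" "y \<in> W" using edge_in xy by blast+
    then have "d x w \<noteq> Suc s" "d y w \<noteq> s"
      using dist_step'[OF vw, of x] dist_step'[OF vw, of y] xy(3,4) by linarith+
    then have "d y w = Suc s"
      using xy(1) xy' by (metis doubleton_eq_iff)
    then show "e \<in> branch (Suc s) v w" using xy unfolding branch_def by blast
  qed
  then show ?thesis using Suc by auto
qed

lemma branch_zero:
  assumes "{v, w} \<in> F"
  shows "branch 0 v w = {{v, w}}"
  using arc_eq_branch[OF assms, of 0] by simp

text \<open>
Every edge of the sphere is sorted by the unique direction in which its far endpoint is seen from
v.
\<close>

lemma sphere_eq_branches:
  assumes "v \<in> W"
  shows "edge_sphere W F r v = (\<Union>w\<in>{w. {v, w} \<in> F}. branch r v w)"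
proof (intro equalityI subsetI)
  fix e assume "e \<in> edge_sphere W F r v"
  then obtain x y where xy: "e = {x, y}" "{x, y} \<in> F" "d x v = r" "d y v = Suc r"
    using assms by (auto simp: edge_sphere_iff)
  then have "y \<in> W" "y \<noteq> v" using edge_in dist_self assms by fastforce+
  then obtain w where "{v, w} \<in> F" "d y v = Suc (d y w)"
    using closer_neighbour[OF assms] by blast
  then show "e \<in> (\<Union>w\<in>{w. {v, w} \<in> F}. branch r v w)"
    using xy unfolding branch_def by auto
next
  fix e assume "e \<in> (\<Union>w\<in>{w. {v, w} \<in> F}. branch r v w)"
  then show "e \<in> edge_sphere W F r v" using assms by (auto simp: edge_sphere_iff branch_def)
qed

lemma branches_disjoint:
  assumes "{v, w} \<in> F" "{v, w'} \<in> F" "w \<noteq> w'"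
  shows "branch r v w \<inter> branch r v w' = {}"
proof (rule ccontr)
  assume "\<not> ?thesis"
  then obtain x y x' y' where *: "{x, y} = {x', y'}" "{x, y} \<in> F" "d x v = r" "d y v = Suc r"
    "d y w = r" "d x' v = r" "d y' v = Suc r" "d y' w' = r"
    unfolding branch_def by auto
  then have "y = y'" by (auto simp: doubleton_eq_iff)
  moreover have "y \<in> W" using edge_in * by blast
  ultimately show False using closer_unique[OF assms(1,2), of y] * assms(3) by simp
qed

text \<open>
This is one step of the non-backtracking walk: edges beyond (v, w) at radius r + 1 are the edges
seen from w at radius r in any direction other than back to v.
\<close>

lemma branch_Suc:
  assumes vw: "{v, w} \<in> F"
  shows "branch (Suc r) v w = (\<Union>x\<in>{x. {w, x} \<in> F} - {v}. branch r w x)"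
proof (intro equalityI subsetI)
  have W: "v \<in> W" "w \<in> W" using edge_in vw by blast+
  fix e
  {
    assume "e \<in> branch (Suc r) v w"
    then obtain x y where xy: "e = {x, y}" "{x, y} \<in> F" "d x v = Suc r" "d y v = Suc (Suc r)"
      "d y w = Suc r" unfolding branch_def by blast
    then have dx: "d x w = r" using near_endpoint_follows[OF vw] by blast
    have "y \<in> W" "y \<noteq> w" using edge_in dist_self W xy by fastforce+
    then obtain z where "{w, z} \<in> F" "d y w = Suc (d y z)"
      using closer_neighbour[OF W(2)] by blast
    then show "e \<in> (\<Union>x\<in>{x. {w, x} \<in> F} - {v}. branch r w x)"
      using xy dx by (intro UN_I[of z]) (auto simp: branch_def)
  }
  {
    assume "e \<in> (\<Union>x\<in>{x. {w, x} \<in> F} - {v}. branch r w x)"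
    then obtain z x y where z: "{w, z} \<in> F" "z \<noteq> v" and xy: "e = {x, y}" "{x, y} \<in> F"
      "d x w = r" "d y w = Suc r" "d y z = r" unfolding branch_def by blast
    have yx: "y \<in> W" "x \<in> W" using edge_in xy by blast+
    have wv: "{w, v} \<in> F" using vw by (simp add: insert_commute)
    have dy: "d y v = Suc (Suc r)"
      using dist_step'[OF wv yx(1)] closer_unique[OF wv z(1) yx(1)] xy(4,5) z(2) by metis
    have "d x v = Suc r"
      using dist_step'[OF wv yx(2)] dist_step[OF xy(2) W(1)] dy xy(3) by linarith
    then show "e \<in> branch (Suc r) v w" using dy xy unfolding branch_def by blast
  }
qed

text \<open>
If \<open>\<pi>\<close> is a local bijection to a graph of degree q + 1 and h is a lift of H, the
recursion for branches turns into the recursion that defines the powers of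
\<^term>\<open>nb_average\<close>.
\<close>

lemma branch_sum:
  fixes \<pi> :: "'v \<Rightarrow> 'a" and N :: "'a \<Rightarrow> 'a set" and h :: "'v set \<Rightarrow> real"
  assumes cov: "\<And>w. w \<in> W \<Longrightarrow> bij_betw \<pi> {x. {w, x} \<in> F} (N (\<pi> w))"
    and card: "\<And>w. w \<in> W \<Longrightarrow> card (N (\<pi> w)) = Suc q"
    and q: "q > 0"
    and h: "\<And>x y. {x, y} \<in> F \<Longrightarrow> h {x, y} = H (\<pi> x) (\<pi> y)"
    and vw: "{v, w} \<in> F"
  shows "finite (branch r v w) \<and> card (branch r v w) = q ^ r \<and>
    sum h (branch r v w) = real q ^ r * (nb_average N q ^^ r) H (\<pi> v) (\<pi> w)"
  using vw
proof (induction r arbitrary: v w)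
  case 0
  then show ?case using h by (simp add: branch_zero)
next
  case (Suc r)
  let ?X = "{x. {w, x} \<in> F} - {v}"
  have W: "w \<in> W" "{w, v} \<in> F" using edge_in Suc.prems by (auto simp: insert_commute)
  have finN: "finite (N (\<pi> w))" using card[OF W(1)] card.infinite by fastforce
  then have fin: "finite {x. {w, x} \<in> F}" using bij_betw_finite[OF cov[OF W(1)]] by simp
  have cardX: "card ?X = q"
    using bij_betw_same_card[OF cov[OF W(1)]] card[OF W(1)] W(2) by simp
  have bij: "bij_betw \<pi> ?X (N (\<pi> w) - {\<pi> v})"
    using cov[OF W(1)] W(2) by (auto simp: bij_betw_def inj_on_def)
  have disj: "\<forall>i\<in>?X. \<forall>j\<in>?X. i \<noteq> j \<longrightarrow> branch r w i \<inter> branch r w j = {}"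
    using branches_disjoint by blast
  have IH: "finite (branch r w x)" "card (branch r w x) = q ^ r"
    "sum h (branch r w x) = real q ^ r * (nb_average N q ^^ r) H (\<pi> w) (\<pi> x)"
    if "x \<in> ?X" for x using Suc.IH[of w x] that by auto
  have "sum h (branch (Suc r) v w) = (\<Sum>x\<in>?X. sum h (branch r w x))"
    unfolding branch_Suc[OF Suc.prems] using fin IH(1) disj by (intro sum.UNION_disjoint) auto
  also have "\<dots> = (\<Sum>x\<in>?X. real q ^ r * (nb_average N q ^^ r) H (\<pi> w) (\<pi> x))"
    using IH(3) by (intro sum.cong) auto
  also have "\<dots> = real q ^ r * (\<Sum>x\<in>N (\<pi> w) - {\<pi> v}. (nb_average N q ^^ r) H (\<pi> w) x)"
    using sum.reindex_bij_betw[OF bij] by (simp add: sum_distrib_left)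
  also have "\<dots> = real q ^ Suc r * (nb_average N q ^^ Suc r) H (\<pi> v) (\<pi> w)"
    using q by (simp add: nb_average_def)
  finally have "sum h (branch (Suc r) v w) = \<dots>" .
  moreover have "card (branch (Suc r) v w) = (\<Sum>x\<in>?X. card (branch r w x))"
    unfolding branch_Suc[OF Suc.prems] using fin IH(1) disj by (intro card_UN_disjoint) auto
  then have "card (branch (Suc r) v w) = q ^ Suc r" using IH(2) cardX by simp
  moreover have "finite (branch (Suc r) v w)"
    unfolding branch_Suc[OF Suc.prems] using fin IH(1) by auto
  ultimately show ?case by blast
qed

lemma sphere_sum:
  fixes \<pi> :: "'v \<Rightarrow> 'a" and N :: "'a \<Rightarrow> 'a set" and h :: "'v set \<Rightarrow> real"
  assumes cov: "\<And>w. w \<in> W \<Longrightarrow> bij_betw \<pi> {x. {w, x} \<in> F} (N (\<pi> w))"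
    and card: "\<And>w. w \<in> W \<Longrightarrow> card (N (\<pi> w)) = Suc q"
    and q: "q > 0"
    and h: "\<And>x y. {x, y} \<in> F \<Longrightarrow> h {x, y} = H (\<pi> x) (\<pi> y)"
    and v: "v \<in> W"
  shows "finite (edge_sphere W F r v) \<and> card (edge_sphere W F r v) = Suc q * q ^ r \<and>
    sum h (edge_sphere W F r v) = real q ^ r * (\<Sum>u\<in>N (\<pi> v). (nb_average N q ^^ r) H (\<pi> v) u)"
proof -
  let ?X = "{x. {v, x} \<in> F}"
  have finN: "finite (N (\<pi> v))" using card[OF v] card.infinite by fastforce
  then have fin: "finite ?X" using bij_betw_finite[OF cov[OF v]] by simp
  have cardX: "card ?X = Suc q" using bij_betw_same_card[OF cov[OF v]] card[OF v] by simp
  have disj: "\<forall>i\<in>?X. \<forall>j\<in>?X. i \<noteq> j \<longrightarrow> branch r v i \<inter> branch r v j = {}"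
    using branches_disjoint by blast
  have B: "finite (branch r v x)" "card (branch r v x) = q ^ r"
    "sum h (branch r v x) = real q ^ r * (nb_average N q ^^ r) H (\<pi> v) (\<pi> x)"
    if "x \<in> ?X" for x using branch_sum[of \<pi> N q h H, OF cov card q h] that by auto
  have "sum h (edge_sphere W F r v) = (\<Sum>x\<in>?X. sum h (branch r v x))"
    unfolding sphere_eq_branches[OF v] using fin B(1) disj by (intro sum.UNION_disjoint) auto
  also have "\<dots> = (\<Sum>x\<in>?X. real q ^ r * (nb_average N q ^^ r) H (\<pi> v) (\<pi> x))"
    using B(3) by (intro sum.cong) auto
  also have "\<dots> = real q ^ r * (\<Sum>u\<in>N (\<pi> v). (nb_average N q ^^ r) H (\<pi> v) u)"
    using sum.reindex_bij_betw[OF cov[OF v]] by (simp add: sum_distrib_left)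
  finally have "sum h (edge_sphere W F r v) = \<dots>" .
  moreover have "card (edge_sphere W F r v) = (\<Sum>x\<in>?X. card (branch r v x))"
    unfolding sphere_eq_branches[OF v] using fin B(1) disj by (intro card_UN_disjoint) auto
  then have "card (edge_sphere W F r v) = Suc q * q ^ r" using B(2) cardX by simp
  moreover have "finite (edge_sphere W F r v)"
    unfolding sphere_eq_branches[OF v] using fin B(1) by auto
  ultimately show ?thesis by blast
qed

end

section \<open>The universal cover is a tree\<close>

lemma walk_Cons:
  "walk V E (x # p) \<longleftrightarrow> x \<in> V \<and> (p = [] \<or> {x, hd p} \<in> E \<and> walk V E p)"
proof (cases "p = []")
  case True
  then show ?thesis by (simp add: walk_def)
next
  case False
  have "(\<forall>i. Suc i < length (x # p) \<longrightarrow> {(x # p) ! i, (x # p) ! Suc i} \<in> E) \<longleftrightarrow>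
     {x, hd p} \<in> E \<and> (\<forall>i. Suc i < length p \<longrightarrow> {p ! i, p ! Suc i} \<in> E)"
    (is "?L \<longleftrightarrow> ?R")
  proof
    assume L: ?L
    have "{p ! i, p ! Suc i} \<in> E" if "Suc i < length p" for i
      using L[rule_format, of "Suc i"] that by simp
    moreover have "{x, hd p} \<in> E"
      using L[rule_format, of 0] False by (simp add: hd_conv_nth)
    ultimately show ?R by blast
  next
    assume R: ?R
    show ?L
    proof (intro allI impI)
      fix i assume "Suc i < length (x # p)"
      then show "{(x # p) ! i, (x # p) ! Suc i} \<in> E"
        using R False by (cases i) (auto simp: hd_conv_nth)
    qed
  qed
  then show ?thesis using False unfolding walk_def by auto
qed

text \<open>
A function is the distance to v as soon as it grows by at most one along edges (so no walk can be
shorter) and can be decreased by one at every other vertex (so some walk is that short).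
\<close>

lemma graph_dist_eqI:
  assumes self: "D v = 0"
    and zero: "\<And>x. x \<in> W \<Longrightarrow> D x = 0 \<Longrightarrow> x = v"
    and lip: "\<And>x y. {x, y} \<in> F \<Longrightarrow> D x \<le> Suc (D y)"
    and descend: "\<And>x n. x \<in> W \<Longrightarrow> D x = Suc n \<Longrightarrow> \<exists>y\<in>W. {x, y} \<in> F \<and> D y = n"
    and u: "u \<in> W"
  shows "graph_dist W F u v = D u"
  unfolding graph_dist_def
proof (rule Least_equality)
  have "\<exists>p. walk W F p \<and> hd p = x \<and> last p = v \<and> length p = Suc n"
    if "x \<in> W" "D x = n" for x n
    using that
  proof (induction n arbitrary: x)
    case 0
    then show ?case using zero[of x] by (intro exI[of _ "[x]"]) (auto simp: walk_Cons)
  next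
    case (Suc n)
    obtain y where y: "y \<in> W" "{x, y} \<in> F" "D y = n" using descend[OF Suc.prems] by blast
    obtain p where "walk W F p" "hd p = y" "last p = v" "length p = Suc n"
      using Suc.IH[OF y(1,3)] by blast
    moreover from this have "p \<noteq> []" by auto
    ultimately show ?case using Suc.prems y
      by (intro exI[of _ "x # p"]) (auto simp: walk_Cons)
  qed
  then show "\<exists>p. walk W F p \<and> hd p = u \<and> last p = v \<and> length p = Suc (D u)"
    using u by blast
  fix n assume "\<exists>p. walk W F p \<and> hd p = u \<and> last p = v \<and> length p = Suc n"
  then obtain p where "walk W F p" "hd p = u" "last p = v" "length p = Suc n" by blast
  then show "D u \<le> n"
  proof (induction p arbitrary: u n)
    case Nil
    then show ?case by simp
  next
    case (Cons x p)
    show ?case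
    proof (cases "p = []")
      case True
      then show ?thesis using Cons.prems self by simp
    next
      case False
      then obtain m where m: "n = Suc m" using Cons.prems by (cases n) auto
      have "D (hd p) \<le> m" using Cons.IH[of "hd p" m] Cons.prems False m by (simp add: walk_Cons)
      moreover have "{u, hd p} \<in> F" using Cons.prems False by (simp add: walk_Cons)
      ultimately show ?thesis using lip m by fastforce
    qed
  qed
qed

lemma longest_common_prefix_snoc:
  "longest_common_prefix (p @ [x]) q =
    (if prefix (p @ [x]) q then p @ [x] else longest_common_prefix p q)"
proof (induction p q rule: longest_common_prefix.induct)
  case ("2_1" ys)
  then show ?case by (cases ys) auto
qed auto

lemma longest_common_prefix_commute:
  "longest_common_prefix p q = longest_common_prefix q p"
  by (induction p q rule: longest_common_prefix.induct) (auto elim: longest_common_prefix.elims)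

text \<open>
The length of the route between two non-backtracking paths that first deletes steps down to their
longest common prefix and then appends steps. For vertices of the universal cover this is the
graph distance.
\<close>

definition prefix_dist :: "'a list \<Rightarrow> 'a list \<Rightarrow> nat" where
  "prefix_dist p q = length p + length q - 2 * length (longest_common_prefix p q)"

lemma prefix_dist_commute: "prefix_dist p q = prefix_dist q p"
  using longest_common_prefix_commute[of p q] by (simp add: prefix_dist_def add.commute)

lemma longest_common_prefix_length:
  "length (longest_common_prefix p q) \<le> length p"
  "length (longest_common_prefix p q) \<le> length q"
  using longest_common_prefix_prefix1[of p q] longest_common_prefix_prefix2[of p q]
    prefix_length_le by blast+

lemma longest_common_prefix_eq_left: "prefix p q \<Longrightarrow> longest_common_prefix p q = p"
  by (induction p q rule: longest_common_prefix.induct) auto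

lemma prefix_dist_snoc:
  "prefix (p @ [x]) q \<Longrightarrow> prefix_dist p q = Suc (prefix_dist (p @ [x]) q)"
  "\<not> prefix (p @ [x]) q \<Longrightarrow> prefix_dist (p @ [x]) q = Suc (prefix_dist p q)"
proof -
  assume pre: "prefix (p @ [x]) q"
  then have "prefix p q" using append_prefixD by blast
  then show "prefix_dist p q = Suc (prefix_dist (p @ [x]) q)"
    using prefix_length_le[OF pre] pre
    by (simp add: prefix_dist_def longest_common_prefix_eq_left)
next
  assume "\<not> prefix (p @ [x]) q"
  then show "prefix_dist (p @ [x]) q = Suc (prefix_dist p q)"
    using longest_common_prefix_length[of p q]
    by (simp add: prefix_dist_def longest_common_prefix_snoc)
qed

lemma prefix_dist_zero: "prefix_dist p q = 0 \<longleftrightarrow> p = q"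
proof
  assume *: "prefix_dist p q = 0"
  then have "length (longest_common_prefix p q) = length p"
    "length (longest_common_prefix p q) = length q"
    using longest_common_prefix_length[of p q] by (auto simp: prefix_dist_def)
  then show "p = q"
    using longest_common_prefix_prefix1[of p q] longest_common_prefix_prefix2[of p q]
    by (metis prefix_order.order_iff_strict prefix_length_less less_irrefl)
qed (simp add: prefix_dist_def longest_common_prefix_eq_left)

lemma cover_edge_iff:
  "{p, p'} \<in> cover_edges V E rt \<longleftrightarrow> p \<in> cover_verts V E rt \<and> p' \<in> cover_verts V E rt \<and>
     (\<exists>x. p' = p @ [x] \<or> p = p' @ [x])"
  unfolding cover_edges_def by (auto simp: doubleton_eq_iff)

lemma cover_verts_nonempty: "p \<in> cover_verts V E rt \<Longrightarrow> p \<noteq> []"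
  by (simp add: cover_verts_def walk_def)

lemma cover_verts_hd: "p \<in> cover_verts V E rt \<Longrightarrow> hd p = rt"
  unfolding cover_verts_def by blast

lemma cover_verts_prefix:
  assumes "p @ z \<in> cover_verts V E rt" "p \<noteq> []"
  shows "p \<in> cover_verts V E rt"
proof -
  have w: "walk V E (p @ z)" "hd (p @ z) = rt"
    and n: "\<And>i. i + 2 < length (p @ z) \<Longrightarrow> (p @ z) ! i \<noteq> (p @ z) ! (i + 2)"
    using assms(1) by (auto simp: cover_verts_def)
  have "{p ! i, p ! Suc i} \<in> E" if "Suc i < length p" for i
  proof -
    have "{(p @ z) ! i, (p @ z) ! Suc i} \<in> E" using w(1) that unfolding walk_def by simp
    then show ?thesis using that by (simp add: nth_append)
  qed
  moreover have "p ! i \<noteq> p ! (i + 2)" if "i + 2 < length p" for i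
    using n[of i] that by (simp add: nth_append)
  ultimately show ?thesis using w assms(2) by (auto simp: cover_verts_def walk_def)
qed

text \<open>
Towards y one either moves one step further along y, or, when v is not an initial part of y, has
to retreat. The two cases exclude each other, which is why the direction towards y is unique.
\<close>

lemma cover_closer_iff:
  assumes "{v, w} \<in> cover_edges V E rt"
  shows "prefix_dist v y = Suc (prefix_dist w y) \<longleftrightarrow>
    (\<exists>x. w = v @ [x] \<and> prefix w y \<or> v = w @ [x] \<and> \<not> prefix v y)"
    "prefix_dist v y = Suc (prefix_dist w y) \<or> prefix_dist w y = Suc (prefix_dist v y)"
proof -
  consider x where "w = v @ [x]" | x where "v = w @ [x]"
    using assms by (auto simp: cover_edge_iff)
  then have "(prefix_dist v y = Suc (prefix_dist w y) \<longleftrightarrow>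
      (\<exists>x. w = v @ [x] \<and> prefix w y \<or> v = w @ [x] \<and> \<not> prefix v y)) \<and>
    (prefix_dist v y = Suc (prefix_dist w y) \<or> prefix_dist w y = Suc (prefix_dist v y))"
  proof cases
    case 1
    then have "\<And>z. v \<noteq> w @ [z]" by auto
    then show ?thesis using 1 prefix_dist_snoc[of v x y] by (cases "prefix w y") auto
  next
    case 2
    then have "\<And>z. w \<noteq> v @ [z]" by auto
    then show ?thesis using 2 prefix_dist_snoc[of w x y] by (cases "prefix v y") auto
  qed
  then show "prefix_dist v y = Suc (prefix_dist w y) \<longleftrightarrow>
    (\<exists>x. w = v @ [x] \<and> prefix w y \<or> v = w @ [x] \<and> \<not> prefix v y)"
    "prefix_dist v y = Suc (prefix_dist w y) \<or> prefix_dist w y = Suc (prefix_dist v y)"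
    by blast+
qed

lemma cover_closer_ex1:
  assumes v: "v \<in> cover_verts V E rt" and y: "y \<in> cover_verts V E rt" and "v \<noteq> y"
  shows "\<exists>!w. {v, w} \<in> cover_edges V E rt \<and> prefix_dist v y = Suc (prefix_dist w y)"
proof (rule ex_ex1I)
  show "\<exists>w. {v, w} \<in> cover_edges V E rt \<and> prefix_dist v y = Suc (prefix_dist w y)"
  proof (cases "prefix v y")
    case True
    then obtain x z where z: "y = (v @ [x]) @ z"
      using \<open>v \<noteq> y\<close> by (metis append.assoc append_Cons append_Nil append_Nil2 neq_Nil_conv prefixE)
    then have "{v, v @ [x]} \<in> cover_edges V E rt"
      using v y cover_verts_prefix[of "v @ [x]" z] by (auto simp: cover_edge_iff)
    then show ?thesis using z prefix_dist_snoc(1)[of v x y] by (metis prefixI)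
  next
    case False
    have ne: "v \<noteq> []" "y \<noteq> []"
      using cover_verts_nonempty[OF v] cover_verts_nonempty[OF y] .
    have hd: "hd v = hd y" using cover_verts_hd[OF v] cover_verts_hd[OF y] by (rule trans[OF _ sym])
    obtain w a where w: "v = w @ [a]" using ne by (cases v rule: rev_cases) auto
    have "w \<noteq> []"
    proof
      assume "w = []"
      moreover obtain b z where "y = b # z" using ne by (cases y) auto
      ultimately show False using False hd w by simp
    qed
    then have "w \<in> cover_verts V E rt" using cover_verts_prefix[of w "[a]"] v w by blast
    then have "{v, w} \<in> cover_edges V E rt" using v w unfolding cover_edge_iff by blast
    then show ?thesis using prefix_dist_snoc(2)[of w a y] w False by blast
  qed
next
  fix w w'
  assume 1: "{v, w} \<in> cover_edges V E rt \<and> prefix_dist v y = Suc (prefix_dist w y)"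
    and 2: "{v, w'} \<in> cover_edges V E rt \<and> prefix_dist v y = Suc (prefix_dist w' y)"
  have one: "x = x'" if "prefix (v @ [x]) y" "prefix (v @ [x']) y" for x x'
    using that by (auto simp: prefix_def)
  have two: "prefix v y" if "prefix (v @ [x]) y" for x using that append_prefixD by blast
  obtain x where x: "w = v @ [x] \<and> prefix w y \<or> v = w @ [x] \<and> \<not> prefix v y"
    using cover_closer_iff(1)[of v w V E rt y] 1 by blast
  obtain x' where x': "w' = v @ [x'] \<and> prefix w' y \<or> v = w' @ [x'] \<and> \<not> prefix v y"
    using cover_closer_iff(1)[of v w' V E rt y] 2 by blast
  show "w = w'"
  proof (cases "prefix v y")
    case True
    then show ?thesis using x x' one by auto
  next
    case False
    then have "v = w @ [x]" "v = w' @ [x']" using x x' two by blast+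
    then show ?thesis by simp
  qed
qed

lemma cover_dist:
  assumes "p \<in> cover_verts V E rt" "p' \<in> cover_verts V E rt"
  shows "graph_dist (cover_verts V E rt) (cover_edges V E rt) p p' = prefix_dist p p'"
proof (rule graph_dist_eqI[where D = "\<lambda>x. prefix_dist x p'"])
  fix x n assume x: "x \<in> cover_verts V E rt" and n: "prefix_dist x p' = Suc n"
  have "x \<noteq> p'" using n prefix_dist_zero[of x p'] by auto
  then show "\<exists>y\<in>cover_verts V E rt. {x, y} \<in> cover_edges V E rt \<and> prefix_dist y p' = n"
    using cover_closer_ex1[OF x assms(2)] n unfolding cover_edge_iff by auto
next
  fix x y assume "{x, y} \<in> cover_edges V E rt"
  then show "prefix_dist x p' \<le> Suc (prefix_dist y p')"
    using cover_closer_iff(2)[of x y V E rt p'] by auto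
qed (use assms in \<open>auto simp: prefix_dist_zero\<close>)

lemma cover_tree_metric: "tree_metric (cover_verts V E rt) (cover_edges V E rt)"
proof (unfold_locales, goal_cases)
  case (1 x y)
  then show ?case by (simp add: cover_edge_iff)
next
  case (2 x)
  then show ?case by (simp add: cover_dist prefix_dist_zero)
next
  case (3 x y)
  then show ?case by (simp add: cover_dist prefix_dist_zero)
next
  case (4 x y)
  then show ?case by (simp add: cover_dist prefix_dist_commute)
next
  case (5 x y v)
  then have "x \<in> cover_verts V E rt" "y \<in> cover_verts V E rt" by (auto simp: cover_edge_iff)
  then show ?case using 5 cover_closer_iff(2) by (simp add: cover_dist)
next
  case (6 v y)
  have "({v, w} \<in> cover_edges V E rt \<and>
      graph_dist (cover_verts V E rt) (cover_edges V E rt) y v =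
      Suc (graph_dist (cover_verts V E rt) (cover_edges V E rt) y w)) \<longleftrightarrow>
     ({v, w} \<in> cover_edges V E rt \<and> prefix_dist v y = Suc (prefix_dist w y))" for w
    using 6 prefix_dist_commute[of y] by (auto simp: cover_dist cover_edge_iff)
  then show ?case using cover_closer_ex1[OF 6] by presburger
qed

text \<open>
The neighbours of a path p are its one-step extensions and the path with its last step removed.
The latter projects onto the one neighbour of the end of p that the non-backtracking condition
forbids to an extension, so each neighbour in the base graph is hit exactly once.
\<close>

lemma cover_projection_bij:
  assumes simple: "simple_graph V E" and p: "p \<in> cover_verts V E rt"
  shows "bij_betw proj_vert {x. {p, x} \<in> cover_edges V E rt} {u. {proj_vert p, u} \<in> E}"
  unfolding bij_betw_def
proof
  have edge: "{last x, last y} \<in> E" if "{x, y} \<in> cover_edges V E rt" for x y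
  proof -
    have *: "{last x, z} \<in> E" if "x @ [z] \<in> cover_verts V E rt" "x \<noteq> []" for x :: "'a list" and z
    proof -
      have "\<forall>i. Suc i < length (x @ [z]) \<longrightarrow> {(x @ [z]) ! i, (x @ [z]) ! Suc i} \<in> E"
        using that(1) unfolding cover_verts_def walk_def by blast
      from this[rule_format, of "length x - 1"] show ?thesis
        using that(2) by (simp add: nth_append last_conv_nth)
    qed
    have "x \<in> cover_verts V E rt" "y \<in> cover_verts V E rt"
      using that unfolding cover_edge_iff by blast+
    then have "x \<noteq> []" "y \<noteq> []" using cover_verts_nonempty[of _ V E rt] by auto
    then show ?thesis
      using that * by (auto simp: cover_edge_iff insert_commute)
  qed
  \<comment> \<open>An extension of the path w @ [a] never projects to the same vertex as the predecessor w.\<close>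
  have turn: "last w \<noteq> x"
    if "(w @ [a]) @ [x] \<in> cover_verts V E rt" "w \<noteq> []" for w a x
  proof -
    have "\<forall>i. i + 2 < length (w @ [a, x]) \<longrightarrow> (w @ [a, x]) ! i \<noteq> (w @ [a, x]) ! (i + 2)"
      using that(1) unfolding cover_verts_def by simp
    from this[rule_format, of "length w - 1"] show ?thesis
      using that(2) by (cases w rule: rev_cases) (auto simp: nth_append)
  qed
  show "inj_on proj_vert {x. {p, x} \<in> cover_edges V E rt}"
  proof (rule inj_onI)
    fix x y assume "x \<in> {x. {p, x} \<in> cover_edges V E rt}" "y \<in> {x. {p, x} \<in> cover_edges V E rt}"
      and eq: "proj_vert x = proj_vert y"
    then have "{p, x} \<in> cover_edges V E rt" "{p, y} \<in> cover_edges V E rt" by auto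
    then obtain a b where xy: "x \<in> cover_verts V E rt" "y \<in> cover_verts V E rt"
      "x = p @ [a] \<or> p = x @ [a]" "y = p @ [b] \<or> p = y @ [b]"
      by (auto simp: cover_edge_iff)
    moreover have "x \<noteq> []" "y \<noteq> []"
      using cover_verts_nonempty[OF xy(1)] cover_verts_nonempty[OF xy(2)] .
    ultimately show "x = y" using eq turn[of x a b] turn[of y b a] by (auto simp: proj_vert_def)
  qed
  show "proj_vert ` {x. {p, x} \<in> cover_edges V E rt} = {u. {proj_vert p, u} \<in> E}"
  proof (intro equalityI subsetI)
    fix u assume "u \<in> {u. {proj_vert p, u} \<in> E}"
    then have u: "{last p, u} \<in> E" by (simp add: proj_vert_def)
    then have "u \<in> V" using simple by (auto simp: simple_graph_def)
    then show "u \<in> proj_vert ` {x. {p, x} \<in> cover_edges V E rt}"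
      using cover_step[OF p _ u] by (auto simp: proj_vert_def)
  qed (use edge in \<open>auto simp: proj_vert_def\<close>)
qed

section \<open>Contraction of the non-backtracking average\<close>

lemma abs_le_if_sq_le:
  fixes a b :: real
  assumes "a\<^sup>2 \<le> b\<^sup>2" "0 \<le> b"
  shows "\<bar>a\<bar> \<le> b"
  using assms abs_le_square_iff[of a b] by simp

lemma average_near_value:
  fixes f :: "'b \<Rightarrow> real"
  assumes "card A > 0" "\<And>x. x \<in> A \<Longrightarrow> \<bar>f x - c\<bar> \<le> s"
  shows "\<bar>(\<Sum>x\<in>A. f x) / real (card A) - c\<bar> \<le> s"
proof -
  have "(\<Sum>x\<in>A. f x) / real (card A) - c = (\<Sum>x\<in>A. f x - c) / real (card A)"
    using assms(1) by (simp add: sum_subtractf field_simps)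
  moreover have "\<bar>\<Sum>x\<in>A. f x - c\<bar> \<le> real (card A) * s"
    using order_trans[OF sum_abs sum_bounded_above, of A "\<lambda>x. f x - c" s] assms(2) by simp
  ultimately show ?thesis using assms(1) by (simp add: field_simps)
qed

locale regular_neighbourhood =
  fixes V :: "'a set" and N :: "'a \<Rightarrow> 'a set" and q :: nat
  assumes finV: "finite V"
    and N_in: "v \<in> V \<Longrightarrow> N v \<subseteq> V"
    and N_sym: "u \<in> V \<Longrightarrow> v \<in> V \<Longrightarrow> u \<in> N v \<longleftrightarrow> v \<in> N u"
    and N_card: "v \<in> V \<Longrightarrow> card (N v) = Suc q"
    and q2: "q \<ge> 2"
begin

abbreviation P :: "('a \<Rightarrow> 'a \<Rightarrow> real) \<Rightarrow> 'a \<Rightarrow> 'a \<Rightarrow> real" where "P \<equiv> nb_average N q"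

definition sq_norm :: "('a \<Rightarrow> 'a \<Rightarrow> real) \<Rightarrow> real" where
  "sq_norm H = (\<Sum>v\<in>V. \<Sum>x\<in>N v. (H v x)\<^sup>2)"

text \<open>
Orthogonality to every function of the tail that is constant on the neighbourhood of each vertex,
that is, constant on the classes of vertices joined by walks of even length. Quantifying over test
functions treats bipartite and non-bipartite graphs alike and never mentions the classes.
\<close>

definition balanced :: "('a \<Rightarrow> 'a \<Rightarrow> real) \<Rightarrow> bool" where
  "balanced H \<longleftrightarrow> (\<forall>g. (\<forall>u\<in>V. \<forall>v\<in>N u. \<forall>w\<in>N u. g v = g w) \<longrightarrow>
     (\<Sum>v\<in>V. \<Sum>x\<in>N v. g v * H v x) = 0)"

lemma finN: "v \<in> V \<Longrightarrow> finite (N v)"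
  using N_in finV finite_subset by blast

lemma sum_reverse:
  fixes f :: "'a \<Rightarrow> 'a \<Rightarrow> real"
  shows "(\<Sum>v\<in>V. \<Sum>x\<in>N v. f v x) = (\<Sum>v\<in>V. \<Sum>x\<in>N v. f x v)"
proof -
  have "(\<Sum>v\<in>V. \<Sum>x\<in>N v. f v x) = (\<Sum>v\<in>V. \<Sum>x | x \<in> V \<and> x \<in> N v. f v x)"
    using N_in by (intro sum.cong) auto
  also have "\<dots> = (\<Sum>x\<in>V. \<Sum>v | v \<in> V \<and> x \<in> N v. f v x)"
    by (rule sum.swap_restrict[OF finV finV])
  also have "\<dots> = (\<Sum>x\<in>V. \<Sum>v\<in>N x. f v x)"
    using N_in N_sym by (intro sum.cong) auto
  finally show ?thesis .
qed

text \<open>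
With S the sum of z and Z the sum of its squares over the q + 1 neighbours, both sides equal (q -
1) ((q + 1) Z - S^2) / q^2; the double sum of squared differences is 2 ((q + 1) Z - S^2).
\<close>

lemma average_sq_loss:
  fixes z :: "'a \<Rightarrow> real"
  assumes v: "v \<in> V"
  shows "(\<Sum>u\<in>N v. (z u)\<^sup>2) - (\<Sum>u\<in>N v. ((\<Sum>x\<in>N v - {u}. z x) / real q)\<^sup>2) =
    (real q - 1) / (2 * (real q)\<^sup>2) * (\<Sum>x\<in>N v. \<Sum>y\<in>N v. (z x - z y)\<^sup>2)"
proof -
  define S where "S = (\<Sum>x\<in>N v. z x)"
  define Z where "Z = (\<Sum>x\<in>N v. (z x)\<^sup>2)"
  have fin: "finite (N v)" and card: "card (N v) = Suc q" using finN N_card v by auto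
  have "(\<Sum>u\<in>N v. ((\<Sum>x\<in>N v - {u}. z x) / real q)\<^sup>2) = (\<Sum>u\<in>N v. (S - z u)\<^sup>2) / (real q)\<^sup>2"
    using fin by (simp add: sum_diff1 S_def power_divide sum_divide_distrib)
  also have "(\<Sum>u\<in>N v. (S - z u)\<^sup>2) = (\<Sum>u\<in>N v. S\<^sup>2 - 2 * S * z u + (z u)\<^sup>2)"
    by (intro sum.cong) (auto simp: power2_eq_square algebra_simps)
  also have "\<dots> = (real q + 1) * S\<^sup>2 - 2 * S * S + Z"
    by (simp add: sum.distrib sum_subtractf card Z_def S_def flip: sum_distrib_left)
  finally have 1: "(\<Sum>u\<in>N v. ((\<Sum>x\<in>N v - {u}. z x) / real q)\<^sup>2) =
      ((real q + 1) * S\<^sup>2 - 2 * S * S + Z) / (real q)\<^sup>2" .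
  have "(\<Sum>x\<in>N v. \<Sum>y\<in>N v. (z x - z y)\<^sup>2) =
      (\<Sum>x\<in>N v. \<Sum>y\<in>N v. (z x)\<^sup>2 - 2 * z x * z y + (z y)\<^sup>2)"
    by (intro sum.cong) (auto simp: power2_eq_square algebra_simps)
  also have "\<dots> = (\<Sum>x\<in>N v. (real q + 1) * (z x)\<^sup>2 - 2 * z x * S + Z)"
    by (simp add: sum.distrib sum_subtractf card Z_def S_def flip: sum_distrib_left)
  also have "\<dots> = (real q + 1) * Z - 2 * S * S + (real q + 1) * Z"
    by (simp add: sum.distrib sum_subtractf card Z_def S_def
        flip: sum_distrib_left sum_distrib_right)
  finally have 2: "(\<Sum>x\<in>N v. \<Sum>y\<in>N v. (z x - z y)\<^sup>2) =
      (real q + 1) * Z - 2 * S * S + (real q + 1) * Z" .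
  have "real q > 0" using q2 by simp
  then show ?thesis unfolding 1 2 Z_def[symmetric]
    by (simp add: field_simps power2_eq_square)
qed

text \<open>
The energy identity. Grouping the edges (u, v) by their head v, the values of P H there are
determined by the values of H on the edges leaving v, so the identity decouples over the vertices.
\<close>

lemma sq_norm_loss:
  "sq_norm H - sq_norm (P H) =
    (real q - 1) / (2 * (real q)\<^sup>2) * (\<Sum>v\<in>V. \<Sum>x\<in>N v. \<Sum>y\<in>N v. (H v x - H v y)\<^sup>2)"
proof -
  have "sq_norm (P H) = (\<Sum>v\<in>V. \<Sum>u\<in>N v. (P H u v)\<^sup>2)"
    unfolding sq_norm_def by (rule sum_reverse)
  then have "sq_norm H - sq_norm (P H) =
     (\<Sum>v\<in>V. (\<Sum>u\<in>N v. (H v u)\<^sup>2) - (\<Sum>u\<in>N v. ((\<Sum>x\<in>N v - {u}. H v x) / real q)\<^sup>2))"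
    unfolding sq_norm_def by (simp add: sum_subtractf nb_average_def)
  also have "\<dots> = (\<Sum>v\<in>V. (real q - 1) / (2 * (real q)\<^sup>2) *
      (\<Sum>x\<in>N v. \<Sum>y\<in>N v. (H v x - H v y)\<^sup>2))"
    by (intro sum.cong refl average_sq_loss)
  finally show ?thesis by (simp add: sum_distrib_left)
qed

lemma sq_norm_decreasing: "sq_norm (P H) \<le> sq_norm H"
proof -
  have "0 \<le> (real q - 1) / (2 * (real q)\<^sup>2) * (\<Sum>v\<in>V. \<Sum>x\<in>N v. \<Sum>y\<in>N v. (H v x - H v y)\<^sup>2)"
    using q2 by (intro mult_nonneg_nonneg sum_nonneg) auto
  then show ?thesis unfolding sq_norm_loss[symmetric] by simp
qed

lemma sq_norm_nonneg: "0 \<le> sq_norm H"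
  unfolding sq_norm_def by (intro sum_nonneg) auto

lemma entry_le_sq_norm:
  assumes "v \<in> V" "x \<in> N v"
  shows "(H v x)\<^sup>2 \<le> sq_norm H"
proof -
  have "(H v x)\<^sup>2 \<le> (\<Sum>x\<in>N v. (H v x)\<^sup>2)"
    using assms finN by (intro member_le_sum) auto
  also have "\<dots> \<le> sq_norm H" unfolding sq_norm_def
    using assms finV by (intro member_le_sum[of v V "\<lambda>v. \<Sum>x\<in>N v. (H v x)\<^sup>2"]) (auto intro: sum_nonneg)
  finally show ?thesis .
qed

lemma spread_le_loss:
  assumes v: "v \<in> V" and x: "x \<in> N v" and y: "y \<in> N v"
  shows "(H v x - H v y)\<^sup>2 \<le> 2 * (real q)\<^sup>2 * (sq_norm H - sq_norm (P H))"
proof -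
  let ?f = "\<lambda>v x y. (H v x - H v y)\<^sup>2"
  have "?f v x y \<le> (\<Sum>y\<in>N v. ?f v x y)"
    using v y finN by (intro member_le_sum) auto
  also have "\<dots> \<le> (\<Sum>x\<in>N v. \<Sum>y\<in>N v. ?f v x y)"
    using v x finN by (intro member_le_sum[of x "N v" "\<lambda>x. \<Sum>y\<in>N v. ?f v x y"]) (auto intro: sum_nonneg)
  also have "\<dots> \<le> (\<Sum>v\<in>V. \<Sum>x\<in>N v. \<Sum>y\<in>N v. ?f v x y)"
    using v finV by (intro member_le_sum[of v V "\<lambda>v. \<Sum>x\<in>N v. \<Sum>y\<in>N v. ?f v x y"])
      (auto intro!: sum_nonneg)
  also have "\<dots> \<le> (real q - 1) * (\<Sum>v\<in>V. \<Sum>x\<in>N v. \<Sum>y\<in>N v. ?f v x y)"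
  proof -
    have "0 \<le> (\<Sum>v\<in>V. \<Sum>x\<in>N v. \<Sum>y\<in>N v. ?f v x y)" by (auto intro!: sum_nonneg)
    then show ?thesis using q2 mult_right_mono[of 1 "real q - 1"] by fastforce
  qed
  also have "\<dots> = 2 * (real q)\<^sup>2 * (sq_norm H - sq_norm (P H))"
    unfolding sq_norm_loss using q2 by simp
  finally show ?thesis .
qed

text \<open>
Compare both values through P H. The value P H u v is an average of values H v x', so it is close
to H v x when the first application of P loses little; P H u v is close to P H u w when the second
application loses little. Three steps, each of size at most 2 q times the square root of the loss,
lead from H v x to H w y.
\<close>

lemma two_step_spread:
  assumes u: "u \<in> V" and v: "v \<in> N u" and w: "w \<in> N u" and x: "x \<in> N v" and y: "y \<in> N w"
  shows "\<bar>H v x - H w y\<bar> \<le> 6 * real q * sqrt (sq_norm H - sq_norm (P (P H)))"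
proof -
  define t where "t = sq_norm H - sq_norm (P (P H))"
  define s where "s = 2 * real q * sqrt t"
  have t: "sq_norm H - sq_norm (P H) \<le> t" "sq_norm (P H) - sq_norm (P (P H)) \<le> t" "0 \<le> t"
    using sq_norm_decreasing[of H] sq_norm_decreasing[of "P H"] by (auto simp: t_def)
  have small: "\<bar>a\<bar> \<le> s" if "a\<^sup>2 \<le> 2 * (real q)\<^sup>2 * b" "b \<le> t" for a b
  proof -
    have "a\<^sup>2 \<le> 2 * (real q)\<^sup>2 * t" using that by (meson mult_left_mono order_trans zero_le_power2 mult_nonneg_nonneg zero_le_numeral)
    also have "\<dots> \<le> 4 * (real q)\<^sup>2 * t" using t(3) by (intro mult_right_mono) auto
    also have "\<dots> = s\<^sup>2" using t(3) by (simp add: s_def power_mult_distrib)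
    finally have "a\<^sup>2 \<le> s\<^sup>2" .
    moreover have "0 \<le> s" using t(3) by (simp add: s_def)
    ultimately show ?thesis by (rule abs_le_if_sq_le)
  qed
  have spread: "\<bar>H v x - H v y\<bar> \<le> s" if "v \<in> V" "x \<in> N v" "y \<in> N v" for v x y
    using small[OF spread_le_loss[OF that] t(1)] .
  have spread': "\<bar>P H v x - P H v y\<bar> \<le> s" if "v \<in> V" "x \<in> N v" "y \<in> N v" for v x y
    using small[OF spread_le_loss[OF that] t(2)] .
  have step: "\<bar>P H u v - H v x\<bar> \<le> s" if "v \<in> N u" "x \<in> N v" for v x
  proof -
    have v: "v \<in> V" "u \<in> N v" using that u N_in N_sym by blast+
    have "card (N v - {u}) = q" using v N_card[OF v(1)] by simp
    then show ?thesis
      using average_near_value[of "N v - {u}" "H v" "H v x" s] spread[OF v(1)] that q2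
      by (simp add: nb_average_def)
  qed
  show ?thesis
    using step[OF v x] step[OF w y] spread'[OF u v w] by (simp add: s_def t_def)
qed

definition two_apart :: "('a \<times> 'a) set" where
  "two_apart = {(v, w). \<exists>u\<in>V. v \<in> N u \<and> w \<in> N u}"

lemma two_apart_subset: "two_apart \<subseteq> V \<times> V"
  using N_in unfolding two_apart_def by blast

text \<open>
Any two vertices of one even-walk class are joined by at most card two_apart moves, so all values
on the edges leaving the class are within card two_apart * s of H v x; since those values average
to zero by balance, H v x itself is that small.
\<close>

lemma balanced_entry_bound:
  assumes bal: "balanced H" and v: "v \<in> V" and x: "x \<in> N v"
    and s0: "0 \<le> s"
    and near: "\<And>v w x y. (v, w) \<in> two_apart \<Longrightarrow> x \<in> N v \<Longrightarrow> y \<in> N w \<Longrightarrow> \<bar>H v x - H w y\<bar> \<le> s"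
  shows "\<bar>H v x\<bar> \<le> real (card two_apart) * s"
proof -
  let ?K = "real (card two_apart)"
  have ne: "N w \<noteq> {}" if "w \<in> V" for w using N_card[OF that] by auto
  have fin: "finite two_apart" using two_apart_subset finV finite_subset by blast
  obtain u where "u \<in> N v" using ne[OF v] by blast
  then have "u \<in> V" "v \<in> N u" using v N_in N_sym by blast+
  then have refl: "(v, v) \<in> two_apart" unfolding two_apart_def by blast
  then have K1: "?K \<ge> 1" using fin by (simp add: Suc_le_eq card_gt_0_iff) (use refl in blast)
  \<comment> \<open>For n = 0 the bound would be 0, which fails for w = v and y different from x.\<close>
  have pow: "w \<in> V \<and> (\<forall>y\<in>N w. \<bar>H v x - H w y\<bar> \<le> real n * s)"
    if "(v, w) \<in> two_apart ^^ n" "n > 0" for n w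
    using that
  proof (induction n arbitrary: w)
    case (Suc n)
    obtain z where z: "(v, z) \<in> two_apart ^^ n" "(z, w) \<in> two_apart" using Suc.prems by auto
    have w: "w \<in> V" "z \<in> V" using z two_apart_subset by auto
    show ?case
    proof (cases "n = 0")
      case True
      then have "z = v" using z by simp
      then show ?thesis using near[OF z(2)] x w True by simp
    next
      case False
      obtain b where b: "b \<in> N z" using ne w by blast
      then have "\<bar>H v x - H z b\<bar> \<le> real n * s" using Suc.IH[OF z(1)] False by simp
      then show ?thesis using near[OF z(2) b] w by (force simp: algebra_simps)
    qed
  qed simp
  define cl where "cl = {w. (v, w) \<in> two_apart\<^sup>*}"
  have cl: "w \<in> V \<and> (\<forall>y\<in>N w. \<bar>H v x - H w y\<bar> \<le> ?K * s)" if "w \<in> cl" for w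
  proof -
    have "(v, w) \<in> (\<Union>n\<in>{n. n \<le> card two_apart}. two_apart ^^ n)"
      using that rtrancl_finite_eq_relpow[OF fin] by (simp add: cl_def)
    then obtain n where n: "n \<le> card two_apart" "(v, w) \<in> two_apart ^^ n" by (elim UN_E) simp
    show ?thesis
    proof (cases "n = 0")
      case True
      \<comment> \<open>Stepping to a neighbour and back replaces the empty chain from v to v.\<close>
      then have "(v, w) \<in> two_apart ^^ 1" using n refl by simp
      then have "w \<in> V \<and> (\<forall>y\<in>N w. \<bar>H v x - H w y\<bar> \<le> 1 * s)" using pow[of w 1] by simp
      then show ?thesis using mult_right_mono[OF K1 s0] by fastforce
    next
      case False
      then have "w \<in> V \<and> (\<forall>y\<in>N w. \<bar>H v x - H w y\<bar> \<le> real n * s)" using pow n by blast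
      moreover have "real n * s \<le> ?K * s" using n s0 by (intro mult_right_mono) auto
      ultimately show ?thesis by fastforce
    qed
  qed
  define g :: "'a \<Rightarrow> real" where "g w = (if w \<in> cl then 1 else 0)" for w
  have "g w = g w'" if "u \<in> V" "w \<in> N u" "w' \<in> N u" for u w w'
  proof -
    have "(w, w') \<in> two_apart" "(w', w) \<in> two_apart" using that unfolding two_apart_def by blast+
    then show ?thesis unfolding g_def cl_def by (auto intro: rtrancl_into_rtrancl)
  qed
  then have "(\<Sum>w\<in>V. \<Sum>y\<in>N w. g w * H w y) = 0" using bal unfolding balanced_def by blast
  moreover have "(\<Sum>w\<in>V. \<Sum>y\<in>N w. g w * H w y) = (\<Sum>w\<in>cl. \<Sum>y\<in>N w. H w y)"
    using finV cl by (intro sum.mono_neutral_cong_right) (auto simp: g_def finN)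
  ultimately have zero: "(\<Sum>w\<in>cl. \<Sum>y\<in>N w. H w y) = 0" by simp
  have "cl \<subseteq> V" using cl by blast
  then have fincl: "finite cl" using finV by (rule finite_subset)
  have "v \<in> cl" by (simp add: cl_def)
  have fins: "\<forall>w\<in>cl. finite (N w)" using \<open>cl \<subseteq> V\<close> finN by blast
  define D where "D = Sigma cl N"
  have finD: "finite D" unfolding D_def using fincl fins by (intro finite_SigmaI) auto
  have "(v, x) \<in> D" using \<open>v \<in> cl\<close> x by (simp add: D_def)
  then have cardD: "card D > 0" using finD by (auto simp: card_gt_0_iff)
  have "(\<Sum>p\<in>D. case p of (w, y) \<Rightarrow> H w y) = 0"
    using zero sum.Sigma[OF fincl fins, of "\<lambda>w y. H w y"] by (simp add: D_def)
  moreover have "\<bar>(case p of (w, y) \<Rightarrow> H w y) - H v x\<bar> \<le> ?K * s" if "p \<in> D" for p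
    using that cl by (auto simp: D_def abs_minus_commute[of _ "H v x"])
  ultimately show ?thesis
    using average_near_value[OF cardD, of "\<lambda>(w, y). H w y" "H v x" "?K * s"] by simp
qed

text \<open>
Let t be the energy that P \<circ> P loses on H. Every value of H is bounded by a constant times
the square root of t, hence sq_norm H is at most c * t for a constant c of the graph, and the
energy that is left is at most (1 - 1/c) sq_norm H.
\<close>

lemma two_step_contraction:
  "\<exists>\<rho>. 0 < \<rho> \<and> \<rho> < 1 \<and> (\<forall>H. balanced H \<longrightarrow> sq_norm (P (P H)) \<le> \<rho> * sq_norm H)"
proof -
  define K where "K = real (card two_apart)"
  define M where "M = real (card V) * real (Suc q)"
  \<comment> \<open>The summand 2 keeps the factor 1 - 1/c strictly between 0 and 1.\<close>
  define c where "c = 36 * M * K\<^sup>2 * (real q)\<^sup>2 + 2"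
  have c: "c \<ge> 2" unfolding c_def M_def by simp
  have "sq_norm (P (P H)) \<le> (1 - 1 / c) * sq_norm H" if bal: "balanced H" for H
  proof -
    define t where "t = sq_norm H - sq_norm (P (P H))"
    have t: "0 \<le> t"
      using sq_norm_decreasing[of H] sq_norm_decreasing[of "P H"] by (simp add: t_def)
    define b where "b = K * (6 * real q * sqrt t)"
    have "\<bar>H v x\<bar> \<le> b" if "v \<in> V" "x \<in> N v" for v x
      unfolding b_def K_def
    proof (rule balanced_entry_bound[OF bal that])
      show "0 \<le> 6 * real q * sqrt t" using t by simp
      show "\<bar>H v x - H w y\<bar> \<le> 6 * real q * sqrt t"
        if "(v, w) \<in> two_apart" "x \<in> N v" "y \<in> N w" for v w x y
        using that two_step_spread[of _ v w x y H] unfolding t_def two_apart_def by blast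
    qed
    then have "(H v x)\<^sup>2 \<le> b\<^sup>2" if "v \<in> V" "x \<in> N v" for v x
      using that by (metis abs_ge_zero power2_abs power_mono)
    then have "sq_norm H \<le> (\<Sum>v\<in>V. \<Sum>x\<in>N v. b\<^sup>2)"
      unfolding sq_norm_def by (intro sum_mono) auto
    also have "\<dots> = M * b\<^sup>2" by (simp add: N_card M_def)
    also have "\<dots> = 36 * M * K\<^sup>2 * (real q)\<^sup>2 * t"
      using t by (simp add: b_def power_mult_distrib)
    also have "\<dots> \<le> c * t" unfolding c_def using t by (intro mult_right_mono) auto
    finally have "sq_norm H / c \<le> t" using c by (simp add: field_simps)
    then show ?thesis by (simp add: t_def algebra_simps)
  qed
  then show ?thesis using c by (intro exI[of _ "1 - 1 / c"]) (auto simp: field_simps)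
qed

text \<open>
The adjoint of P maps a test function g of the tail to the function g' whose value at v is the
common value of g on the neighbours of v; this g' is again constant on every neighbourhood.
\<close>

lemma balanced_average:
  assumes "balanced H"
  shows "balanced (P H)"
  unfolding balanced_def
proof (intro allI impI)
  fix g :: "'a \<Rightarrow> real"
  assume g: "\<forall>u\<in>V. \<forall>v\<in>N u. \<forall>w\<in>N u. g v = g w"
  define g' where "g' v = g (SOME w. w \<in> N v)" for v
  have ne: "N w \<noteq> {}" if "w \<in> V" for w using N_card[OF that] by auto
  have g': "g' v = g w" if "v \<in> V" "w \<in> N v" for v w
  proof -
    have "(SOME w. w \<in> N v) \<in> N v" using ne[OF that(1)] by (simp add: some_in_eq)
    then show ?thesis using g that unfolding g'_def by blast
  qed
  have "g' v = g' w" if "u \<in> V" "v \<in> N u" "w \<in> N u" for u v w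
  proof -
    have "v \<in> V" "w \<in> V" "u \<in> N v" "u \<in> N w" using that N_in N_sym by blast+
    then show ?thesis using g'[of v u] g'[of w u] by simp
  qed
  then have 0: "(\<Sum>v\<in>V. \<Sum>x\<in>N v. g' v * H v x) = 0"
    using assms unfolding balanced_def by blast
  have "(\<Sum>u\<in>V. \<Sum>v\<in>N u. g u * P H u v) = (\<Sum>v\<in>V. \<Sum>u\<in>N v. g u * P H u v)"
    by (rule sum_reverse)
  also have "\<dots> = (\<Sum>v\<in>V. \<Sum>x\<in>N v. g' v * H v x)"
  proof (rule sum.cong[OF refl])
    fix v assume v: "v \<in> V"
    have "(\<Sum>u\<in>N v. P H u v) = (\<Sum>u\<in>N v. (\<Sum>x\<in>N v. H v x) - H v u) / real q"
      using finN[OF v] by (simp add: nb_average_def sum_diff1 sum_divide_distrib)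
    also have "\<dots> = (\<Sum>x\<in>N v. H v x)"
      using N_card[OF v] q2 by (simp add: sum_subtractf field_simps)
    finally have *: "(\<Sum>u\<in>N v. P H u v) = (\<Sum>x\<in>N v. H v x)" .
    have "(\<Sum>u\<in>N v. g u * P H u v) = g' v * (\<Sum>u\<in>N v. P H u v)"
      using g'[OF v] by (simp add: sum_distrib_left)
    then show "(\<Sum>u\<in>N v. g u * P H u v) = (\<Sum>x\<in>N v. g' v * H v x)"
      by (simp add: * sum_distrib_left)
  qed
  finally show "(\<Sum>u\<in>V. \<Sum>v\<in>N u. g u * P H u v) = 0" using 0 by simp
qed

lemma balanced_power: "balanced H \<Longrightarrow> balanced ((P ^^ r) H)"
  by (induction r) (auto intro: balanced_average)

text \<open>
Let g' v be the common value of g on the neighbours of v. Then g + g' takes the same value at both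
ends of every edge, so it is a constant c. By symmetry of H, twice the inner product of g and H is
the sum of (g v + g x) H v x = c H v x, which vanishes.
\<close>

lemma symmetric_balanced:
  assumes sym: "\<And>u v. H u v = H v u"
    and zero: "(\<Sum>v\<in>V. \<Sum>x\<in>N v. H v x) = 0"
    and conn: "\<And>h :: 'a \<Rightarrow> real. (\<forall>u\<in>V. \<forall>v\<in>N u. h u = h v) \<Longrightarrow> \<exists>c. \<forall>u\<in>V. h u = c"
  shows "balanced H"
  unfolding balanced_def
proof (intro allI impI)
  fix g :: "'a \<Rightarrow> real"
  assume g: "\<forall>u\<in>V. \<forall>v\<in>N u. \<forall>w\<in>N u. g v = g w"
  define g' where "g' v = g (SOME w. w \<in> N v)" for v
  have g': "g' v = g w" if "v \<in> V" "w \<in> N v" for v w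
  proof -
    have "(SOME w. w \<in> N v) \<in> N v" using that by (metis someI_ex)
    then show ?thesis using g that unfolding g'_def by blast
  qed
  have "g u + g' u = g v + g' v" if "u \<in> V" "v \<in> N u" for u v
  proof -
    have "v \<in> V" "u \<in> N v" using that N_in N_sym by blast+
    then show ?thesis using g'[of u v] g'[of v u] that by simp
  qed
  then obtain c where c: "\<And>u. u \<in> V \<Longrightarrow> g u + g' u = c"
    using conn[of "\<lambda>u. g u + g' u"] by blast
  let ?S = "\<Sum>v\<in>V. \<Sum>x\<in>N v. g v * H v x"
  have "?S = (\<Sum>v\<in>V. \<Sum>x\<in>N v. g x * H v x)"
    using sum_reverse[of "\<lambda>v x. g v * H v x"] sym by simp
  then have "2 * ?S = (\<Sum>v\<in>V. \<Sum>x\<in>N v. g v * H v x) + (\<Sum>v\<in>V. \<Sum>x\<in>N v. g x * H v x)"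
    by simp
  also have "\<dots> = (\<Sum>v\<in>V. \<Sum>x\<in>N v. (g v + g x) * H v x)"
    by (simp add: sum.distrib algebra_simps)
  also have "\<dots> = (\<Sum>v\<in>V. \<Sum>x\<in>N v. c * H v x)"
    using c g' by (intro sum.cong refl) (metis)
  also have "\<dots> = 0" using zero by (simp flip: sum_distrib_left)
  finally show "?S = 0" by simp
qed

lemma sq_norm_power:
  assumes \<rho>: "\<And>H. balanced H \<Longrightarrow> sq_norm (P (P H)) \<le> \<rho> * sq_norm H" "0 \<le> \<rho>"
    and bal: "balanced H"
  shows "sq_norm ((P ^^ r) H) \<le> \<rho> ^ (r div 2) * sq_norm H"
proof -
  have even: "sq_norm ((P ^^ (2 * k)) H) \<le> \<rho> ^ k * sq_norm H" for k
  proof (induction k)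
    case (Suc k)
    have "sq_norm ((P ^^ (2 * Suc k)) H) \<le> \<rho> * sq_norm ((P ^^ (2 * k)) H)"
      using \<rho>(1)[OF balanced_power[OF bal]] by simp
    also have "\<dots> \<le> \<rho> * (\<rho> ^ k * sq_norm H)" using Suc \<rho>(2) by (rule mult_left_mono)
    finally show ?case by (simp add: mult.assoc)
  qed simp
  show ?thesis
  proof (cases "even r")
    case True
    then show ?thesis using even[of "r div 2"] by simp
  next
    case False
    then have r: "r = Suc (2 * (r div 2))" by simp
    have "sq_norm ((P ^^ r) H) \<le> sq_norm ((P ^^ (2 * (r div 2))) H)"
      by (subst r) (simp add: sq_norm_decreasing)
    then show ?thesis using even[of "r div 2"] by linarith
  qed
qed

text \<open>
The exponent r div 2 counts complete double steps; the factor \<open>\<beta>\<close> on the left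
pays for the single step left over when r is odd. As \<open>\<rho>\<close> contracts squared norms
over two steps, its fourth root is the rate for one step of the unsquared norm.
\<close>

lemma exponential_decay:
  "\<exists>\<beta>. real q powr (- 1 / 2) \<le> \<beta> \<and> \<beta> < 1 \<and>
    (\<forall>H r v x. balanced H \<longrightarrow> v \<in> V \<longrightarrow> x \<in> N v \<longrightarrow>
       \<beta> * \<bar>(P ^^ r) H v x\<bar> \<le> \<beta> ^ r * sqrt (sq_norm H))"
proof -
  obtain \<rho> where \<rho>: "0 < \<rho>" "\<rho> < 1" "\<And>H. balanced H \<Longrightarrow> sq_norm (P (P H)) \<le> \<rho> * sq_norm H"
    using two_step_contraction by blast
  define \<beta> where "\<beta> = max (sqrt (sqrt \<rho>)) (real q powr (- 1 / 2))"
  have q1: "real q > 1" using q2 by simp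
  have "real q powr (- 1 / 2) < 1" using powr_less_one[OF q1, of "-1/2"] by simp
  then have \<beta>: "real q powr (- 1 / 2) \<le> \<beta>" "sqrt (sqrt \<rho>) \<le> \<beta>" "\<beta> < 1" "0 < \<beta>"
    using \<rho> q1 by (auto simp: \<beta>_def less_max_iff_disj)
  have "(sqrt (sqrt \<rho>)) ^ 4 = ((sqrt (sqrt \<rho>))\<^sup>2)\<^sup>2" by (simp flip: power_mult)
  then have "\<rho> = (sqrt (sqrt \<rho>)) ^ 4" using \<rho>(1) by simp
  then have \<rho>\<beta>: "\<rho> \<le> \<beta> ^ 4" using \<rho>(1) \<beta>(2) power_mono[of "sqrt (sqrt \<rho>)" \<beta> 4] by simp
  have "\<beta> * \<bar>(P ^^ r) H v x\<bar> \<le> \<beta> ^ r * sqrt (sq_norm H)"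
    if "balanced H" "v \<in> V" "x \<in> N v" for H r v x
  proof -
    define k where "k = r div 2"
    have "((P ^^ r) H v x)\<^sup>2 \<le> \<rho> ^ k * sq_norm H"
      using entry_le_sq_norm[OF that(2,3)] sq_norm_power[OF \<rho>(3) _ that(1)] \<rho>(1)
      unfolding k_def by (meson less_imp_le order_trans)
    also have "\<dots> \<le> (\<beta> ^ 4) ^ k * sq_norm H"
      using \<rho>\<beta> \<rho>(1) sq_norm_nonneg by (intro mult_right_mono power_mono) auto
    also have "\<dots> = (\<beta> ^ (2 * k) * sqrt (sq_norm H))\<^sup>2"
      using sq_norm_nonneg by (simp add: power_mult_distrib flip: power_mult)
    finally have "((P ^^ r) H v x)\<^sup>2 \<le> (\<beta> ^ (2 * k) * sqrt (sq_norm H))\<^sup>2" .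
    moreover have "0 \<le> \<beta> ^ (2 * k) * sqrt (sq_norm H)"
      using \<beta>(4) sq_norm_nonneg[of H] by (intro mult_nonneg_nonneg) simp_all
    ultimately have "\<bar>(P ^^ r) H v x\<bar> \<le> \<beta> ^ (2 * k) * sqrt (sq_norm H)"
      by (rule abs_le_if_sq_le)
    then have "\<beta> * \<bar>(P ^^ r) H v x\<bar> \<le> \<beta> * (\<beta> ^ (2 * k) * sqrt (sq_norm H))"
      by (rule mult_left_mono) (use \<beta>(4) in simp)
    also have "\<dots> = \<beta> ^ Suc (2 * k) * sqrt (sq_norm H)" by simp
    also have "\<dots> \<le> \<beta> ^ r * sqrt (sq_norm H)"
    proof (rule mult_right_mono)
      have "r \<le> Suc (2 * k)" unfolding k_def by presburger
      then show "\<beta> ^ Suc (2 * k) \<le> \<beta> ^ r"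
        by (rule power_decreasing) (use \<beta>(3,4) in simp_all)
    qed (simp add: sq_norm_nonneg)
    finally show ?thesis .
  qed
  then show ?thesis using \<beta> by blast
qed

end

section \<open>Counting edges, and the convergence of arc and sphere means\<close>

lemma edge_endpoints:
  assumes "simple_graph V E" "{u, v} \<in> E"
  shows "u \<in> V" "v \<in> V" "u \<noteq> v"
  using assms by (auto simp: simple_graph_def)

lemma incident_edges_bij:
  assumes "simple_graph V E"
  shows "bij_betw (\<lambda>x. {v, x}) {x. {v, x} \<in> E} {e \<in> E. v \<in> e}"
  unfolding bij_betw_def
proof
  show "inj_on (\<lambda>x. {v, x}) {x. {v, x} \<in> E}" by (auto simp: inj_on_def doubleton_eq_iff)
  have "e \<in> (\<lambda>x. {v, x}) ` {x. {v, x} \<in> E}" if e: "e \<in> E" "v \<in> e" for e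
  proof -
    have "card e = 2" using e assms by (auto simp: simple_graph_def)
    then obtain a b where "e = {a, b}" by (auto simp: card_2_iff)
    then have "\<exists>x. e = {v, x}" using e by auto
    then show ?thesis using e by auto
  qed
  then show "(\<lambda>x. {v, x}) ` {x. {v, x} \<in> E} = {e \<in> E. v \<in> e}" by auto
qed

lemma finite_edges: "finite V \<Longrightarrow> simple_graph V E \<Longrightarrow> finite E"
  by (rule finite_subset[of E "Pow V"]) (auto simp: simple_graph_def)

text \<open>
Every edge is met from both of its endpoints.
\<close>

lemma handshake_sum:
  fixes \<phi> :: "'a set \<Rightarrow> real"
  assumes V: "finite V" and simple: "simple_graph V E"
  shows "(\<Sum>v\<in>V. \<Sum>x | {v, x} \<in> E. \<phi> {v, x}) = 2 * (\<Sum>e\<in>E. \<phi> e)"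
proof -
  have E: "finite E" using finite_edges[OF assms] .
  have "(\<Sum>v\<in>V. \<Sum>x | {v, x} \<in> E. \<phi> {v, x}) = (\<Sum>v\<in>V. \<Sum>e | e \<in> E \<and> v \<in> e. \<phi> e)"
    using sum.reindex_bij_betw[OF incident_edges_bij[OF simple]] by (intro sum.cong) auto
  also have "\<dots> = (\<Sum>e\<in>E. \<Sum>v | v \<in> V \<and> v \<in> e. \<phi> e)"
    by (rule sum.swap_restrict[OF V E])
  also have "\<dots> = (\<Sum>e\<in>E. 2 * \<phi> e)"
  proof (rule sum.cong[OF refl])
    fix e assume "e \<in> E"
    then have "{v. v \<in> V \<and> v \<in> e} = e" "card e = 2" using simple by (auto simp: simple_graph_def)
    then show "(\<Sum>v | v \<in> V \<and> v \<in> e. \<phi> e) = 2 * \<phi> e" by simp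
  qed
  finally show ?thesis by (simp add: sum_distrib_left)
qed

lemma edge_degree_pair:
  assumes V: "finite V" and simple: "simple_graph V E" and e: "{u, v} \<in> E"
  shows "edge_degree E {u, v} = (degree E u - 1) + (degree E v - 1)"
proof -
  have E: "finite E" using finite_edges[OF V simple] .
  let ?A = "{e \<in> E. u \<in> e} - {{u, v}}" and ?B = "{e \<in> E. v \<in> e} - {{u, v}}"
  have two: "card e' = 2" if "e' \<in> E" for e' using that simple by (auto simp: simple_graph_def)
  have uv: "u \<noteq> v" using edge_endpoints[OF simple e] by simp
  have "{e' \<in> E. e' \<noteq> {u, v} \<and> e' \<inter> {u, v} \<noteq> {}} = ?A \<union> ?B" by auto
  moreover have "?A \<inter> ?B = {}"
  proof -
    have "e' = {u, v}" if "e' \<in> E" "u \<in> e'" "v \<in> e'" for e'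
    proof -
      have "card e' = 2" using two that(1) .
      then obtain a b where "e' = {a, b}" by (auto simp: card_2_iff)
      then show ?thesis using that uv by auto
    qed
    then show ?thesis by blast
  qed
  moreover have "card ?A = degree E u - 1" "card ?B = degree E v - 1"
    using E e by (simp_all add: degree_def)
  ultimately show ?thesis using E by (simp add: edge_degree_def card_Un_disjoint)
qed

lemma mean_minus_const:
  assumes "finite A" "card A > 0"
  shows "mean A g - m = (\<Sum>x\<in>A. g x - m) / real (card A)"
  using assms by (simp add: mean_def sum_subtractf diff_divide_distrib card_gt_0_iff)

lemma connected_locally_constant:
  assumes conn: "connected_graph V E" and h: "\<And>u v. {u, v} \<in> E \<Longrightarrow> h u = h v"
  shows "\<exists>c. \<forall>u\<in>V. h u = c"
proof -
  obtain u where u: "u \<in> V" using conn by (auto simp: connected_graph_def)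
  have walk: "h (hd p) = h (last p)" if "walk V E p" for p
    using that
  proof (induction p)
    case (Cons x p)
    then show ?case using h by (cases "p = []") (auto simp: walk_Cons)
  qed (simp add: walk_def)
  have "h v = h u" if "v \<in> V" for v
    using conn u that walk unfolding connected_graph_def by metis
  then show ?thesis by blast
qed

lemma variance_le:
  fixes f :: "'b \<Rightarrow> real"
  assumes "finite A" "A \<noteq> {}"
  shows "(\<Sum>x\<in>A. (f x - mean A f)\<^sup>2) \<le> (\<Sum>x\<in>A. (f x)\<^sup>2)"
proof -
  let ?m = "mean A f"
  have c: "card A > 0" using assms by (simp add: card_gt_0_iff)
  have m: "sum f A = real (card A) * ?m" using c by (simp add: mean_def)
  have "(\<Sum>x\<in>A. (f x - ?m)\<^sup>2) = (\<Sum>x\<in>A. (f x)\<^sup>2 - 2 * ?m * f x + ?m\<^sup>2)"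
    by (intro sum.cong refl) (simp add: power2_eq_square algebra_simps)
  also have "\<dots> = (\<Sum>x\<in>A. (f x)\<^sup>2) - 2 * ?m * sum f A + real (card A) * ?m\<^sup>2"
    by (simp add: sum.distrib sum_subtractf sum_distrib_left)
  also have "\<dots> = (\<Sum>x\<in>A. (f x)\<^sup>2) - real (card A) * ?m\<^sup>2"
    unfolding m by (simp add: power2_eq_square)
  finally show ?thesis by simp
qed

lemma cover_edge_projects:
  assumes "simple_graph V E" "{p, p'} \<in> cover_edges V E rt"
  shows "{proj_vert p, proj_vert p'} \<in> E"
proof -
  have "p \<in> cover_verts V E rt" using assms(2) by (simp add: cover_edge_iff)
  from bij_betw_apply[OF cover_projection_bij[OF assms(1) this]] assms(2)
  show ?thesis by simp
qed

theorem corollary2: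
  fixes V :: "'a set" and E :: "'a set set" and q :: nat
  assumes "finite V"
    and "simple_graph V E"
    and "connected_graph V E"
    and "regular_graph V E"
    and "\<forall>e\<in>E. edge_degree E e = 2 * q"
    and "2 * q \<ge> 4"
  shows "\<exists>C>0. \<forall>f :: 'a set \<Rightarrow> real.
           \<exists>\<beta> \<in> {1 / real q} \<union> {real q powr (- 1 / 2)..<1}.
             \<forall>rt\<in>V.
               (\<forall>a\<in>directed_edges E. \<forall>b\<in>arc_lifts V E rt a. \<forall>r.
                  \<bar>arc_mean V E rt r b f - mean E f\<bar> \<le> C * edge_norm E f * \<beta> ^ r) \<and>
               (\<forall>v\<^sub>0\<in>cover_verts V E rt. \<forall>r.
                  \<bar>mean (cover_sphere V E rt r v\<^sub>0) (lift_fun f) - mean E f\<bar>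
                    \<le> C * edge_norm E f * \<beta> ^ r)"
proof (cases "E = {}")
  case True
  \<comment> \<open>The graph is a single vertex: all spheres are empty and every mean is 0 by convention.\<close>
  have "cover_edges V E rt = {}" for rt
  proof -
    have "{p, p'} \<notin> cover_edges V E rt" for p p'
      using cover_edge_projects[OF assms(2), of p p' rt] True by auto
    then show ?thesis unfolding cover_edges_def by blast
  qed
  then show ?thesis using True
    by (intro exI[of _ 1])
      (auto simp: directed_edges_def cover_sphere_def edge_sphere_def mean_def
        edge_norm_def edge_inner_def)
next
  case False
  define N where "N u = {x. {u, x} \<in> E}" for u
  have E: "finite E" using finite_edges[OF assms(1,2)] .
  obtain k where k: "\<And>v. v \<in> V \<Longrightarrow> degree E v = k"
    using assms(4) by (auto simp: regular_graph_def)
  have "k = Suc q"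
  proof -
    obtain e where e: "e \<in> E" using False by blast
    then have "card e = 2" using assms(2) by (auto simp: simple_graph_def)
    then obtain u v where uv: "e = {u, v}" by (auto simp: card_2_iff)
    then have "u \<in> V" "v \<in> V" using edge_endpoints assms(2) e by metis+
    then have "2 * q = (k - 1) + (k - 1)"
      using edge_degree_pair[OF assms(1,2), of u v] assms(5) e uv k by auto
    then show ?thesis using assms(6) by linarith
  qed
  then have N_card: "card (N v) = Suc q" if "v \<in> V" for v
    using bij_betw_same_card[OF incident_edges_bij[OF assms(2), of v]] k[OF that]
    by (simp add: degree_def N_def)
  have mem: "v \<in> N u \<longleftrightarrow> {u, v} \<in> E" for u v by (simp add: N_def)
  interpret regular_neighbourhood V N q
  proof
    show "N v \<subseteq> V" for v using edge_endpoints[OF assms(2)] by (auto simp: mem)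
    show "u \<in> N v \<longleftrightarrow> v \<in> N u" for u v by (simp add: mem insert_commute)
  qed (use assms N_card in auto)
  obtain \<beta> where \<beta>: "real q powr (- 1 / 2) \<le> \<beta>" "\<beta> < 1"
    and decay: "\<And>H r v x. balanced H \<Longrightarrow> v \<in> V \<Longrightarrow> x \<in> N v \<Longrightarrow>
       \<beta> * \<bar>(P ^^ r) H v x\<bar> \<le> \<beta> ^ r * sqrt (sq_norm H)"
    using exponential_decay by blast
  have "0 < real q powr (- 1 / 2)" using q2 by simp
  then have \<beta>0: "0 < \<beta>" using \<beta> by linarith
  define C where "C = sqrt 2 / \<beta>"
  have main: "(\<forall>a\<in>directed_edges E. \<forall>b\<in>arc_lifts V E rt a. \<forall>r.
        \<bar>arc_mean V E rt r b f - mean E f\<bar> \<le> C * edge_norm E f * \<beta> ^ r) \<and>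
      (\<forall>v\<^sub>0\<in>cover_verts V E rt. \<forall>r.
        \<bar>mean (cover_sphere V E rt r v\<^sub>0) (lift_fun f) - mean E f\<bar>
          \<le> C * edge_norm E f * \<beta> ^ r)" for rt and f :: "'a set \<Rightarrow> real"
  proof -
    let ?W = "cover_verts V E rt" and ?F = "cover_edges V E rt"
    interpret tree: tree_metric ?W ?F by (rule cover_tree_metric)
    \<comment> \<open>Subtracting the mean on both levels reduces everything to the decay of powers of P on H.\<close>
    define m where "m = mean E f"
    define H where "H u v = f {u, v} - m" for u v
    define h where "h e = lift_fun f e - m" for e :: "'a list set"
    have "(\<Sum>e\<in>E. f e - m) = 0"
      using E False by (simp add: sum_subtractf m_def mean_def)
    then have "(\<Sum>v\<in>V. \<Sum>x\<in>N v. H v x) = 0"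
      using handshake_sum[OF assms(1,2), of "\<lambda>e. f e - m"] by (simp add: H_def N_def)
    then have bal: "balanced H"
    proof (intro symmetric_balanced)
      fix g :: "'a \<Rightarrow> real" assume "\<forall>u\<in>V. \<forall>v\<in>N u. g u = g v"
      then show "\<exists>c. \<forall>u\<in>V. g u = c"
        using edge_endpoints[OF assms(2)] by (intro connected_locally_constant[OF assms(3)]) (auto simp: mem)
    qed (auto simp: H_def insert_commute)
    have "sq_norm H = 2 * (\<Sum>e\<in>E. (f e - m)\<^sup>2)"
      using handshake_sum[OF assms(1,2), of "\<lambda>e. (f e - m)\<^sup>2"] by (simp add: sq_norm_def H_def N_def)
    also have "\<dots> \<le> 2 * edge_inner E f f"
      using variance_le[OF E False, of f] by (simp add: m_def edge_inner_def power2_eq_square)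
    finally have "sqrt (sq_norm H) \<le> sqrt 2 * edge_norm E f"
      unfolding edge_norm_def by (simp flip: real_sqrt_mult)
    then have "\<beta> ^ r * sqrt (sq_norm H) \<le> \<beta> ^ r * (sqrt 2 * edge_norm E f)" for r
      using \<beta>0 by (intro mult_left_mono) auto
    then have "\<beta> * \<bar>(P ^^ r) H v x\<bar> \<le> \<beta> ^ r * (sqrt 2 * edge_norm E f)"
      if "v \<in> V" "x \<in> N v" for v x r
      using decay[OF bal that] order_trans by blast
    then have bound: "\<bar>(P ^^ r) H v x\<bar> \<le> C * edge_norm E f * \<beta> ^ r"
      if "v \<in> V" "x \<in> N v" for v x r
      using that \<beta>0 by (simp add: C_def field_simps)
    have inV: "proj_vert p \<in> V" if "p \<in> ?W" for p
      using that by (auto simp: cover_verts_def walk_def proj_vert_def)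
    have cov: "bij_betw proj_vert {x. {p, x} \<in> ?F} (N (proj_vert p))" if "p \<in> ?W" for p
      unfolding N_def using cover_projection_bij[OF assms(2) that] .
    have card: "card (N (proj_vert p)) = Suc q" if "p \<in> ?W" for p
      using N_card inV that by blast
    have hH: "h {x, y} = H (proj_vert x) (proj_vert y)" for x y
      by (simp add: h_def H_def lift_fun_def proj_edge_def)
    have q0: "0 < q" using q2 by simp
    show ?thesis
    proof (intro conjI ballI allI)
      fix a b r assume "b \<in> arc_lifts V E rt a"
      then obtain p p' where b: "b = (p, p')" "{p, p'} \<in> ?F"
        by (auto simp: arc_lifts_def directed_edges_def)
      have sum: "finite (tree.branch r p p')" "card (tree.branch r p p') = q ^ r"
        "sum h (tree.branch r p p') = real q ^ r * (P ^^ r) H (proj_vert p) (proj_vert p')"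
        using tree.branch_sum[of proj_vert N q h H, OF cov card q0 hH b(2)] by blast+
      have "arc_mean V E rt r b f - m = (P ^^ r) H (proj_vert p) (proj_vert p')"
        using mean_minus_const[OF sum(1), of "lift_fun f" m] sum q0 b
        by (simp add: arc_mean_def tree.arc_eq_branch h_def)
      moreover have "proj_vert p \<in> V" "proj_vert p' \<in> N (proj_vert p)"
        using cover_edge_projects[OF assms(2) b(2)] edge_endpoints[OF assms(2)] by (auto simp: mem)
      ultimately show "\<bar>arc_mean V E rt r b f - mean E f\<bar> \<le> C * edge_norm E f * \<beta> ^ r"
        using bound by (simp add: m_def)
    next
      fix p r assume p: "p \<in> ?W"
      let ?S = "cover_sphere V E rt r p"
      have sum: "finite ?S" "card ?S = Suc q * q ^ r"
        "sum h ?S = real q ^ r * (\<Sum>u\<in>N (proj_vert p). (P ^^ r) H (proj_vert p) u)"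
        using tree.sphere_sum[of proj_vert N q h H, OF cov card q0 hH p]
        unfolding cover_sphere_def by blast+
      have "mean ?S (lift_fun f) - m = sum h ?S / real (card ?S)"
        using mean_minus_const[OF sum(1), of "lift_fun f" m] sum(2) q0 by (simp add: h_def)
      also have "\<dots> = (\<Sum>u\<in>N (proj_vert p). (P ^^ r) H (proj_vert p) u) / real (Suc q)"
        unfolding sum(2,3) of_nat_mult of_nat_power using q0 by (simp del: of_nat_Suc)
      finally show "\<bar>mean ?S (lift_fun f) - mean E f\<bar> \<le> C * edge_norm E f * \<beta> ^ r"
        using average_near_value[of "N (proj_vert p)" "(P ^^ r) H (proj_vert p)" 0] bound
          inV[OF p] card[OF p] by (simp add: m_def)
    qed
  qed
  have "C > 0" using \<beta>0 by (simp add: C_def)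
  moreover have "\<beta> \<in> {1 / real q} \<union> {real q powr (- 1 / 2)..<1}" using \<beta> by simp
  ultimately show ?thesis using main by blast
qed

end
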